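(* Let $D:=\binom nk$, let $\varepsilon_\diamond>0$, $t_{\max}>0$, and put $\delta:=4\varepsilon_\diamond/\sqrt D$. For every $k$-subset $S\subseteq[n]$ let $Z_S:=\bigotimes_{j\in S}Z_j$ (Pauli-$Z$ on the qubits of $S$, identity elsewhere). For each sign vector $v=(v_S)_{S\in\binom{[n]}k}\in\{\pm1\}^D$, where $\binom{[n]}k:=\{S\subseteq[n]:|S|=k\}$, define the $k$-local Hamiltonian $H_v:=\delta\sum_{S\in\binom{[n]}k}v_SZ_S$ and the generator $\mathcal L_v(\rho):=-i[H_v,\rho]$. Any adaptive protocol that uses tensor-product input states, evolutions of duration $t\le t_{\max}$, and single-qubit Pauli measurements, and that outputs an estimator $\widehat{\mathcal L}$ satisfying $$\Pr_{\mathcal L_v}\bigl[\,\|\widehat{\mathcal L}-\mathcal L_v\|_\diamond\le\varepsilon_\diamond\bigr]\ge\frac23$$ uniformly over $v\in\{\pm1\}^D$, requires a number of samples $$N\ge\Omega_k\Bigl(\frac{n^k}{t_{\max}^2\varepsilon_\diamond^2}\Bigr).$$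
   Context: $\|\cdot\|_\diamond$ is the diamond norm of superoperators on $\mathbb M_{2^n}$. One sample (shot) consists of preparing a tensor-product $n$-qubit state, evolving it by $e^{t\mathcal L_v}$ for a time $0\le t\le t_{\max}$, and performing a tensor product of single-qubit Pauli measurements. The choices of input state, evolution time and measurement may depend adaptively on all previous outcomes. $\Pr_{\mathcal L_v}$ is the probability over the protocol's outcomes when the true generator is $\mathcal L_v$. $\Omega_k$ hides a positive constant depending only on $k$. *)

theory Defs
  imports
    "HOL-Library.Ramsey"
    "HOL-Probability.Probability_Measure"
    "Jordan_Normal_Form.Spectral_Radius"
begin

hide_const (open) Finite_Cartesian_Product.mat Finite_Cartesian_Product.vec

section \<open>Matrices on \<open>n\<close> qubits\<close>

text \<open>Operators on \<open>n\<close> qubits are matrices in \<open>carrier_mat (2 ^ n) (2 ^ n)\<close>. The qubits are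
  numbered \<open>0, \<dots>, n - 1\<close>, and a computational basis state is an index \<open>a < 2 ^ n\<close> whose \<open>j\<close>-th
  binary digit is the state of qubit \<open>j\<close>.\<close>

definition tensor :: "nat \<Rightarrow> (nat \<Rightarrow> complex mat) \<Rightarrow> complex mat" where
  "tensor n A = mat (2 ^ n) (2 ^ n)
     (\<lambda>(a, b). \<Prod>j<n. A j $$ (a div 2 ^ j mod 2, b div 2 ^ j mod 2))"

definition mat_trace :: "complex mat \<Rightarrow> complex" where
  "mat_trace A = (\<Sum>i<dim_row A. A $$ (i, i))"

datatype pauli = PauliX | PauliY | PauliZ

primrec pauli_mat :: "pauli \<Rightarrow> complex mat" where
  "pauli_mat PauliX = mat_of_rows_list 2 [[0, 1], [1, 0]]"
| "pauli_mat PauliY = mat_of_rows_list 2 [[0, - \<i>], [\<i>, 0]]"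
| "pauli_mat PauliZ = mat_of_rows_list 2 [[1, 0], [0, - 1]]"

definition density_operator :: "nat \<Rightarrow> complex mat \<Rightarrow> bool" where
  "density_operator d \<rho> \<longleftrightarrow> \<rho> \<in> carrier_mat d d \<and> mat_adjoint \<rho> = \<rho> \<and>
     (\<forall>x \<in> carrier_vec d. 0 \<le> Re ((\<rho> *\<^sub>v x) \<bullet>c x)) \<and> mat_trace \<rho> = 1"

section \<open>Superoperators and the diamond norm\<close>

type_synonym superop = "complex mat \<Rightarrow> complex mat"

definition superoperator :: "nat \<Rightarrow> superop \<Rightarrow> bool" where
  "superoperator d \<Phi> \<longleftrightarrow>
     (\<forall>X \<in> carrier_mat d d. \<Phi> X \<in> carrier_mat d d) \<and>
     (\<forall>X \<in> carrier_mat d d. \<forall>Y \<in> carrier_mat d d. \<Phi> (X + Y) = \<Phi> X + \<Phi> Y) \<and>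
     (\<forall>X \<in> carrier_mat d d. \<forall>c. \<Phi> (c \<cdot>\<^sub>m X) = c \<cdot>\<^sub>m \<Phi> X)"

text \<open>The sum of the singular values, i.e. the trace of \<open>sqrt (X\<^sup>* X)\<close>. The order of \<open>z\<close> as a root of
  the characteristic polynomial is its multiplicity; the eigenvalues of \<open>X\<^sup>* X\<close> are real and
  nonnegative, so \<open>Re\<close> only changes the type.\<close>

definition trace_norm :: "complex mat \<Rightarrow> real" where
  "trace_norm X = (let G = mat_adjoint X * X in
     \<Sum>z \<in> spectrum G. real (Polynomial.order z (char_poly G)) * sqrt (Re z))"

text \<open>\<open>\<Phi> \<otimes> id\<close> with an ancilla of dimension \<open>m\<close>: the basis vector \<open>e\<^sub>i \<otimes> e\<^sub>p\<close> has index \<open>i * m + p\<close>,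
  and \<open>\<Phi>\<close> acts on the \<open>d \<times> d\<close> block of \<open>X\<close> belonging to each pair \<open>(p, q)\<close> of ancilla indices.\<close>

definition tensor_id :: "nat \<Rightarrow> nat \<Rightarrow> superop \<Rightarrow> superop" where
  "tensor_id d m \<Phi> X = mat (d * m) (d * m) (\<lambda>(r, s).
     \<Phi> (mat d d (\<lambda>(i, j). X $$ (i * m + r mod m, j * m + s mod m))) $$ (r div m, s div m))"

text \<open>The trace norm induces the diamond norm with an ancilla of the same dimension as the system.
  For linear \<open>\<Phi>\<close> the set below is bounded, so the real supremum is the intended one.\<close>

definition diamond_norm :: "nat \<Rightarrow> superop \<Rightarrow> real" where
  "diamond_norm d \<Phi> =
     (SUP X \<in> {X \<in> carrier_mat (d * d) (d * d). trace_norm X \<le> 1}. trace_norm (tensor_id d d \<Phi> X))"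

text \<open>The exponential series of \<open>t L\<close> applied to \<open>\<rho>\<close>, summed entrywise.\<close>

definition evolve :: "nat \<Rightarrow> superop \<Rightarrow> real \<Rightarrow> superop" where
  "evolve d L t \<rho> = mat d d (\<lambda>ij. \<Sum>m. of_real (t ^ m / fact m) * ((L ^^ m) \<rho>) $$ ij)"

section \<open>The family of Hamiltonians\<close>

text \<open>\<open>nsets {..<n} k\<close> is the set of \<open>k\<close>-element subsets of \<open>{..<n}\<close>.\<close>

definition Z_string :: "nat \<Rightarrow> nat set \<Rightarrow> complex mat" where
  "Z_string n S = tensor n (\<lambda>j. if j \<in> S then pauli_mat PauliZ else 1\<^sub>m 2)"

definition hamiltonian :: "nat \<Rightarrow> nat \<Rightarrow> real \<Rightarrow> (nat set \<Rightarrow> real) \<Rightarrow> complex mat" where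
  "hamiltonian n k \<delta> v = mat (2 ^ n) (2 ^ n)
     (\<lambda>ab. of_real \<delta> * (\<Sum>S \<in> nsets {..<n} k. of_real (v S) * Z_string n S $$ ab))"

definition generator :: "nat \<Rightarrow> nat \<Rightarrow> real \<Rightarrow> (nat set \<Rightarrow> real) \<Rightarrow> superop" where
  "generator n k \<delta> v \<rho> =
     (- \<i>) \<cdot>\<^sub>m (hamiltonian n k \<delta> v * \<rho> - \<rho> * hamiltonian n k \<delta> v)"

section \<open>Adaptive protocols\<close>

text \<open>The outcome of a shot lists one bit per qubit, \<open>False\<close> for the eigenvalue \<open>+1\<close> and \<open>True\<close> for
  \<open>-1\<close> of the measured Pauli operator. All choices are functions of the list of earlier outcomes
  (oldest first), and the estimate is a function of the list of all outcomes.\<close>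

type_synonym outcome = "bool list"

record protocol =
  input :: "outcome list \<Rightarrow> nat \<Rightarrow> complex mat"
  duration :: "outcome list \<Rightarrow> real"
  basis :: "outcome list \<Rightarrow> nat \<Rightarrow> pauli"
  estimate :: "outcome list \<Rightarrow> superop"

definition transcripts :: "nat \<Rightarrow> nat \<Rightarrow> outcome list set" where
  "transcripts n N = {h. length h = N \<and> (\<forall>b \<in> set h. length b = n)}"

definition valid_protocol :: "nat \<Rightarrow> nat \<Rightarrow> real \<Rightarrow> protocol \<Rightarrow> bool" where
  "valid_protocol n N t_max P \<longleftrightarrow>
     (\<forall>m<N. \<forall>h \<in> transcripts n m.
        (\<forall>j<n. density_operator 2 (input P h j)) \<and> 0 \<le> duration P h \<and> duration P h \<le> t_max) \<and>
     (\<forall>h \<in> transcripts n N. superoperator (2 ^ n) (estimate P h))"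

definition pauli_projector :: "pauli \<Rightarrow> bool \<Rightarrow> complex mat" where
  "pauli_projector p b = (1 / 2) \<cdot>\<^sub>m (1\<^sub>m 2 + (if b then - 1 else 1) \<cdot>\<^sub>m pauli_mat p)"

definition shot_prob :: "nat \<Rightarrow> superop \<Rightarrow> protocol \<Rightarrow> outcome list \<Rightarrow> outcome \<Rightarrow> real" where
  "shot_prob n L P h b = Re (mat_trace
     (tensor n (\<lambda>j. pauli_projector (basis P h j) (b ! j)) *
      evolve (2 ^ n) L (duration P h) (tensor n (input P h))))"

definition transcript_prob :: "nat \<Rightarrow> superop \<Rightarrow> protocol \<Rightarrow> outcome list \<Rightarrow> real" where
  "transcript_prob n L P h = (\<Prod>m<length h. shot_prob n L P (take m h) (h ! m))"

definition success_prob :: "nat \<Rightarrow> nat \<Rightarrow> superop \<Rightarrow> real \<Rightarrow> protocol \<Rightarrow> real" where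
  "success_prob n N L \<epsilon> P =
     (\<Sum>h \<in> {h \<in> transcripts n N. diamond_norm (2 ^ n) (\<lambda>X. estimate P h X - L X) \<le> \<epsilon>}.
        transcript_prob n L P h)"

text \<open>A protocol may also use internal randomness: it is then a probability measure \<open>M\<close> on the
  deterministic protocols above (a point mass if no randomness is used), on any sigma-algebra.
  If the success probability were not measurable in \<open>P\<close>, the integral below would be \<open>0\<close> and
  the protocol could not satisfy the requirement, so measurability need not be assumed.\<close>

definition randomized_protocol :: "nat \<Rightarrow> nat \<Rightarrow> real \<Rightarrow> protocol measure \<Rightarrow> bool" where
  "randomized_protocol n N t_max M \<longleftrightarrow>
     prob_space M \<and> (\<forall>P \<in> space M. valid_protocol n N t_max P)"

definition random_success_prob :: "nat \<Rightarrow> nat \<Rightarrow> superop \<Rightarrow> real \<Rightarrow> protocol measure \<Rightarrow> real" where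
  "random_success_prob n N L \<epsilon> M = (\<integral>P. success_prob n N L \<epsilon> P \<partial>M)"

end

theory Submission
  imports Defs
begin

text \<open>Assouad's method, flipping one sign \<open>v\<^sub>S\<close> at a time. All the Hamiltonians are diagonal, so the flip
  multiplies the evolution by the commuting unitary \<open>exp (2 i t \<delta> v\<^sub>S Z\<^sub>S)\<close>, whose expectation in any
  state has real part \<open>cos (2 \<delta> t)\<close>. By Cauchy-Schwarz the Hellinger affinity of the two outcome
  distributions of a shot is at least \<open>\<bar>cos (2 \<delta> t)\<bar>\<close>, whatever the input and the measurement; this
  survives adaptivity because affinities multiply along a transcript. Hence two neighbouring sign
  vectors can be told apart only if \<open>N (2 \<delta> t_max)\<^sup>2\<close> is bounded below. On the other hand, two
  sign vectors accepting a common estimate disagree in at most one sixteenth of the coordinates, so a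
  protocol that succeeds with probability \<open>2/3\<close> recovers most signs, and
  \<open>N \<ge> D / (1024 \<epsilon>\<^sup>2 t_max\<^sup>2)\<close>.\<close>

section \<open>Binary digits and tensor products\<close>

text \<open>Affinities rather than relative entropies: an outcome may have probability zero under
  one sign vector and not under its neighbour, which makes the relative entropy infinite.

  The threshold behind the constants: an accepted estimate recovers at least 15/16 of the signs, so
  success probability 2/3 yields an average of 5/8 correct signs, strictly more than the 1/2 reached
  by guessing. With s = sqrt (N (2 \<delta> t_max)^2) the overlap of neighbouring transcript laws is
  at least 1 - s, so 5/8 \<le> (1 + s) / 2 and s \<ge> 1/4.

  Internal randomness shapes the order of the argument: no deterministic protocol in the mixture has
  to succeed for every v. The bound therefore concerns the sum of its success probabilities over all
  v, which can be integrated.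

  On the diamond norm only a lower bound by single matrix entries is needed. It comes from comparing
  singular values with the Hilbert-Schmidt norm; the upper bounds there serve only to make the real
  supremum meaningful.\<close>

lemma sum_bits_prod:
  fixes f :: "nat \<Rightarrow> nat \<Rightarrow> 'a::comm_semiring_1"
  shows "(\<Sum>a<2 ^ n. \<Prod>j<n. f j (a div 2 ^ j mod 2)) = (\<Prod>j<n. f j 0 + f j 1)"
proof (induction n)
  case 0
  then show ?case by simp
next
  case (Suc n)
  let ?g = "\<lambda>a. \<Prod>j<n. f j (a div 2 ^ j mod 2)"
  let ?F = "\<lambda>a. \<Prod>j<Suc n. f j (a div 2 ^ j mod 2)"
  \<comment> \<open>The induction splits off the top digit: indices below \<open>2 ^ n\<close> have
    digit 0 there, their shifts by \<open>2 ^ n\<close> have digit 1.\<close>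
  have low: "?F a = ?g a * f n 0" if "a < 2 ^ n" for a
    using that by simp
  have high: "?F (a + 2 ^ n) = ?g a * f n 1" if "a < 2 ^ n" for a
  proof -
    have "(a + 2 ^ n) div 2 ^ j mod 2 = a div 2 ^ j mod 2" if "j < n" for j
    proof -
      \<comment> \<open>For \<open>j < n\<close> the shift \<open>2 ^ n\<close> is an even multiple
        of \<open>2 ^ j\<close>, so it leaves digit \<open>j\<close> unchanged.\<close>
      obtain d where d: "n = Suc d + j"
        using \<open>j < n\<close> by (metis add.commute less_imp_Suc_add add_Suc_right add_Suc)
      have "a + 2 ^ n = a + (2 * 2 ^ d) * 2 ^ j"
        unfolding d by (simp add: power_add)
      then have "(a + 2 ^ n) div 2 ^ j = a div 2 ^ j + 2 * 2 ^ d"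
        by (simp only: div_mult_self1) simp
      then show ?thesis by simp
    qed
    moreover have "(a + 2 ^ n) div 2 ^ n mod 2 = 1"
      using that by simp
    ultimately show ?thesis by simp
  qed
  have "(\<Sum>a<2 ^ Suc n. ?F a) = (\<Sum>a<2 ^ n. ?F a) + (\<Sum>a\<in>{2 ^ n..<2 ^ n + 2 ^ n}. ?F a)"
    by (subst sum.union_disjoint[symmetric]) (auto intro!: sum.cong)
  also have "(\<Sum>a\<in>{2 ^ n..<2 ^ n + 2 ^ n}. ?F a) = (\<Sum>a<2 ^ n. ?F (a + 2 ^ n))"
    using sum.shift_bounds_nat_ivl[of ?F 0 "2 ^ n" "2 ^ n"] by (simp add: lessThan_atLeast0)
  also have "(\<Sum>a<2 ^ n. ?F a) + \<dots> = (\<Sum>a<2 ^ n. ?g a * f n 0) + (\<Sum>a<2 ^ n. ?g a * f n 1)"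
    using low high by (intro arg_cong2[of _ _ _ _ "(+)"] sum.cong) auto
  also have "\<dots> = (\<Sum>a<2 ^ n. ?g a) * (f n 0 + f n 1)"
    by (simp only: sum_distrib_right[symmetric] distrib_left)
  finally show ?case using Suc.IH by simp
qed

lemma bits_eq_iff:
  fixes a b :: nat
  assumes "a < 2 ^ n" "b < 2 ^ n"
  shows "(\<forall>j<n. a div 2 ^ j mod 2 = b div 2 ^ j mod 2) \<longleftrightarrow> a = b"
  using assms
proof (induction n arbitrary: a b)
  case 0
  then show ?case by simp
next
  case (Suc n)
  have "a div 2 < 2 ^ n" "b div 2 < 2 ^ n" using Suc.prems by auto
  note IH = Suc.IH[OF this]
  have "a = b" if *: "\<forall>j<Suc n. a div 2 ^ j mod 2 = b div 2 ^ j mod 2"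
  proof -
    have "a mod 2 = b mod 2" using *[rule_format, of 0] by simp
    moreover have "a div 2 = b div 2"
      using IH *[rule_format, of "Suc _"] by (auto simp: div_mult2_eq)
    ultimately show ?thesis by (metis div_mult_mod_eq)
  qed
  then show ?case by auto
qed

text \<open>Counterpart of \<open>sum_bits_prod\<close> for outcomes, which are lists of bits; here
  the head is split off.\<close>

lemma sum_bool_lists_prod:
  fixes f :: "nat \<Rightarrow> bool \<Rightarrow> 'a::comm_semiring_1"
  shows "(\<Sum>b | length b = n. \<Prod>j<n. f j (b ! j)) = (\<Prod>j<n. f j False + f j True)"
proof (induction n arbitrary: f)
  case 0
  then show ?case by simp
next
  case (Suc n)
  have "{b :: bool list. length b = Suc n} = (\<lambda>(x, b). x # b) ` (UNIV \<times> {b. length b = n})"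
    by (auto simp: length_Suc_conv image_iff)
  moreover have "inj_on (\<lambda>(x, b). x # b) (UNIV \<times> {b :: bool list. length b = n})"
    by (auto simp: inj_on_def)
  ultimately have "(\<Sum>b | length b = Suc n. \<Prod>j<Suc n. f j (b ! j))
      = (\<Sum>(x, b)\<in>UNIV \<times> {b. length b = n}. \<Prod>j<Suc n. f j ((x # b) ! j))"
    by (simp add: sum.reindex case_prod_unfold del: prod.lessThan_Suc)
  also have "\<dots> = (\<Sum>x\<in>UNIV. f 0 x * (\<Sum>b | length b = n. \<Prod>j<n. f (Suc j) (b ! j)))"
    by (subst sum.cartesian_product[symmetric])
       (simp add: prod.lessThan_Suc_shift sum_distrib_left del: prod.lessThan_Suc)
  also have "\<dots> = (\<Prod>j<Suc n. f j False + f j True)"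
    by (simp add: Suc.IH[of "\<lambda>j. f (Suc j)"] UNIV_bool prod.lessThan_Suc_shift algebra_simps del: prod.lessThan_Suc)
  finally show ?case .
qed

text \<open>Positive semidefiniteness in the form K = B B^*. An explicit factor passes directly to
  tensor products and to Cauchy-Schwarz, without a spectral theorem.\<close>

definition gram :: "nat \<Rightarrow> complex mat \<Rightarrow> bool" where
  "gram d K \<longleftrightarrow> (\<exists>B. \<forall>a<d. \<forall>c<d. K $$ (a, c) = (\<Sum>m<d. B a m * cnj (B c m)))"

text \<open>The tensor product of the one-qubit factors is a factor of the tensor product;
  \<open>sum_bits_prod\<close> turns the sum over its inner index into a product over
  qubits.\<close>

lemma gram_tensor:
  assumes "\<And>j. j < n \<Longrightarrow> gram 2 (A j)"
  shows "gram (2 ^ n) (tensor n A)"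
proof -
  have "\<forall>j. \<exists>B. j < n \<longrightarrow>
      (\<forall>a<2. \<forall>c<2. A j $$ (a, c) = (\<Sum>m<(2::nat). B a m * cnj (B c m)))"
    using assms unfolding gram_def by (intro allI) (case_tac "j < n"; simp)
  from choice[OF this] obtain B :: "nat \<Rightarrow> nat \<Rightarrow> nat \<Rightarrow> complex"
    where B: "A j $$ (a, c) = B j a 0 * cnj (B j c 0) + B j a 1 * cnj (B j c 1)"
      if "j < n" "a < 2" "c < 2" for j a c
    by (auto simp: numeral_2_eq_2)
  define C where "C a m = (\<Prod>j<n. B j (a div 2 ^ j mod 2) (m div 2 ^ j mod 2))" for a m :: nat
  have "tensor n A $$ (a, c) = (\<Sum>m<2 ^ n. C a m * cnj (C c m))" if "a < 2 ^ n" "c < 2 ^ n" for a c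
    using that sum_bits_prod[where n=n and f="\<lambda>j m. B j (a div 2 ^ j mod 2) m * cnj (B j (c div 2 ^ j mod 2) m)"]
    by (simp add: tensor_def C_def B prod.distrib)
  then show ?thesis unfolding gram_def by blast
qed

lemma gram_diag:
  assumes "gram d K" "a < d"
  shows "K $$ (a, a) = of_real (Re (K $$ (a, a)))"
proof -
  obtain B where "K $$ (a, a) = (\<Sum>m<d. B a m * cnj (B a m))"
    using assms unfolding gram_def by blast
  also have "\<dots> = of_real (\<Sum>m<d. (cmod (B a m))\<^sup>2)"
    unfolding of_real_sum complex_norm_square ..
  finally show ?thesis by simp
qed

lemma mat_trace_tensor:
  "mat_trace (tensor n A) = (\<Prod>j<n. A j $$ (0, 0) + A j $$ (1, 1))"
  using sum_bits_prod[where n=n and f="\<lambda>j i. A j $$ (i, i)"] by (simp add: mat_trace_def tensor_def)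

text \<open>A Cholesky factorization by hand: the quadratic form, tested on suitable vectors, bounds
  the off-diagonal entry \<open>z\<close> by the diagonal entries \<open>p\<close> and
  \<open>q\<close>.\<close>

lemma density_operator_2D:
  assumes "density_operator 2 R"
  shows "gram 2 R" and "R $$ (0, 0) + R $$ (1, 1) = 1"
proof -
  have R: "R \<in> carrier_mat 2 2" and adj: "mat_adjoint R = R" and tr: "mat_trace R = 1"
    and psd: "\<And>x. x \<in> carrier_vec 2 \<Longrightarrow> 0 \<le> Re ((R *\<^sub>v x) \<bullet>c x)"
    using assms unfolding density_operator_def by auto
  show "R $$ (0, 0) + R $$ (1, 1) = 1"
    using tr R by (simp add: mat_trace_def numeral_2_eq_2)
  have herm: "R $$ (i, j) = cnj (R $$ (j, i))" if "i < 2" "j < 2" for i j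
  proof -
    have "mat_adjoint R $$ (i, j) = cnj (R $$ (j, i))"
      using that R by (simp add: mat_adjoint_def mat_of_rows_index)
    then show ?thesis by (simp add: adj)
  qed
  define z where "z = R $$ (0, 1)"
  define p q where "p = Re (R $$ (0, 0))" and "q = Re (R $$ (1, 1))"
  have "Im (R $$ (i, i)) = 0" if "i < 2" for i
    using arg_cong[OF herm[OF that that], of Im] by simp
  then have e: "R $$ (0, 0) = of_real p" "R $$ (1, 1) = of_real q"
    unfolding p_def q_def by (auto simp: complex_eq_iff)
  have e': "R $$ (1, 0) = cnj z" "R $$ (0, 1) = z"
    using herm[of 1 0] unfolding z_def by simp_all
  have form: "0 \<le> p * (cmod x)\<^sup>2 + q * (cmod y)\<^sup>2 + 2 * Re (z * y * cnj x)" for x y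
  proof -
    have "(R *\<^sub>v vec_of_list [x, y]) \<bullet>c vec_of_list [x, y]
        = (of_real p * x + z * y) * cnj x + (cnj z * x + of_real q * y) * cnj y"
      using R e[unfolded One_nat_def] e'[unfolded One_nat_def] by (simp add: scalar_prod_def numeral_2_eq_2 mult_mat_vec_def)
    also have "Re \<dots> = p * (cmod x)\<^sup>2 + q * (cmod y)\<^sup>2 + 2 * Re (z * y * cnj x)"
      unfolding cmod_power2 by (simp add: algebra_simps power2_eq_square)
    finally have "Re ((R *\<^sub>v vec_of_list [x, y]) \<bullet>c vec_of_list [x, y])
        = p * (cmod x)\<^sup>2 + q * (cmod y)\<^sup>2 + 2 * Re (z * y * cnj x)" .
    moreover have "vec_of_list [x, y] \<in> carrier_vec 2"
      by (rule carrier_vecI) simp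
    ultimately show ?thesis using psd by metis
  qed
  have p0: "0 \<le> p" and q0: "0 \<le> q" using form[of 1 0] form[of 0 1] by auto
  \<comment> \<open>The factor below divides by \<open>sqrt p\<close>; for \<open>p = 0\<close> that
    quotient is 0 by convention, which is correct only if \<open>z\<close> vanishes.\<close>
  have z0: "z = 0" if "p = 0"
  proof (rule ccontr)
    assume "z \<noteq> 0"
    \<comment> \<open>The test vector (-z, s) gives s (q s - 2 |z|^2) \<ge> 0. This choice makes q s
      \<le> |z|^2, a contradiction; the added 1 covers \<open>q = 0\<close>.\<close>
    define s where "s = (cmod z)\<^sup>2 / (q + 1)"
    have s: "s > 0" using \<open>z \<noteq> 0\<close> q0 by (simp add: s_def)
    have "Re (z * of_real s * cnj (- z)) = - s * (cmod z)\<^sup>2"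
      unfolding cmod_power2 by (simp add: algebra_simps power2_eq_square)
    then have "0 \<le> q * s\<^sup>2 - 2 * s * (cmod z)\<^sup>2" using form[of "- z" "of_real s"] that by simp
    then have "0 \<le> s * (q * s - 2 * (cmod z)\<^sup>2)" by (simp add: algebra_simps power2_eq_square)
    then have "2 * (cmod z)\<^sup>2 \<le> q * s" using s by (simp add: zero_le_mult_iff)
    also have "q * s \<le> (q + 1) * s" using s by (simp add: algebra_simps)
    also have "\<dots> = (cmod z)\<^sup>2" using q0 by (simp add: s_def)
    finally show False using \<open>z \<noteq> 0\<close> by simp
  qed
  have det: "(cmod z)\<^sup>2 / p \<le> q"
  proof (cases "p = 0")
    case False
    then have "p > 0" using p0 by simp
    have "Re (z * of_real p * cnj (- z)) = - p * (cmod z)\<^sup>2"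
      unfolding cmod_power2 by (simp add: algebra_simps power2_eq_square)
    then have "0 \<le> p * (q * p - (cmod z)\<^sup>2)"
      using form[of "- z" "of_real p"] by (simp add: algebra_simps power2_eq_square)
    then show ?thesis using \<open>p > 0\<close> by (simp add: zero_le_mult_iff field_simps)
  qed (use q0 in simp)
  \<comment> \<open>The lower triangular Cholesky factor; \<open>det\<close> keeps the last square
    root real.\<close>
  define B :: "nat \<Rightarrow> nat \<Rightarrow> complex" where
    "B a m = (if a = 0 then (if m = 0 then of_real (sqrt p) else 0)
       else (if m = 0 then cnj z / of_real (sqrt p) else of_real (sqrt (q - (cmod z)\<^sup>2 / p))))" for a m
  have "R $$ (a, c) = (\<Sum>m<2. B a m * cnj (B c m))" if "a < 2" "c < 2" for a c
  proof -
    have sq: "of_real (sqrt p) * of_real (sqrt p) = (of_real p :: complex)"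
      using p0 by (simp flip: of_real_mult)
    have 00: "R $$ (0, 0) = (\<Sum>m<2. B 0 m * cnj (B 0 m))"
      by (simp add: B_def numeral_2_eq_2 e sq)
    have 01: "R $$ (0, 1) = (\<Sum>m<2. B 0 m * cnj (B 1 m))"
      using z0 p0 by (cases "p = 0") (simp_all add: B_def numeral_2_eq_2 e'[unfolded One_nat_def])
    have 10: "R $$ (1, 0) = (\<Sum>m<2. B 1 m * cnj (B 0 m))"
      using z0 p0 by (cases "p = 0") (simp_all add: B_def numeral_2_eq_2 e'[unfolded One_nat_def])
    have zz: "cnj z / of_real (sqrt p) * (z / of_real (sqrt p)) = of_real ((cmod z)\<^sup>2 / p)"
      by (simp only: times_divide_times_eq sq of_real_divide complex_norm_square) (simp add: mult.commute)
    have qq: "of_real (sqrt (q - (cmod z)\<^sup>2 / p)) * of_real (sqrt (q - (cmod z)\<^sup>2 / p))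
        = (of_real (q - (cmod z)\<^sup>2 / p) :: complex)"
      using det by (simp flip: of_real_mult)
    have "(\<Sum>m<2. B 1 m * cnj (B 1 m)) = cnj z / of_real (sqrt p) * (z / of_real (sqrt p))
        + of_real (sqrt (q - (cmod z)\<^sup>2 / p)) * of_real (sqrt (q - (cmod z)\<^sup>2 / p))"
      by (simp add: B_def numeral_2_eq_2)
    also have "\<dots> = R $$ (1, 1)"
      unfolding zz qq e by (simp flip: of_real_add)
    finally have 11: "R $$ (1, 1) = (\<Sum>m<2. B 1 m * cnj (B 1 m))" by simp
    have "a = 0 \<or> a = 1" "c = 0 \<or> c = 1" using that by auto
    then show ?thesis using 00 01 10 11 by auto
  qed
  then show "gram 2 R" unfolding gram_def by blast
qed

lemma pauli_projector_entry:
  assumes "i < 2" "j < 2"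
  shows "pauli_projector p b $$ (i, j) =
    ((if i = j then 1 else 0) + (if b then - 1 else 1) * pauli_mat p $$ (i, j)) / 2"
  using assms by (cases p) (auto simp: pauli_projector_def mat_of_rows_list_def)

text \<open>An orthogonal projector is its own factor, since P = P P^*.\<close>

lemma gram_pauli_projector: "gram 2 (pauli_projector p b)"
proof -
  have "pauli_projector p b $$ (i, j)
      = (\<Sum>m<2. pauli_projector p b $$ (i, m) * cnj (pauli_projector p b $$ (j, m)))"
    if "i < 2" "j < 2" for i j
  proof -
    have "i = 0 \<or> i = 1" "j = 0 \<or> j = 1" using that by auto
    then show ?thesis
      by (cases p) (auto simp: numeral_2_eq_2 pauli_projector_entry mat_of_rows_list_def complex_eq_iff)
  qed
  then show ?thesis unfolding gram_def
    by (intro exI[of _ "\<lambda>i m. pauli_projector p b $$ (i, m)"]) blast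
qed

text \<open>Completeness of the measurement: on each qubit the two projectors add up to the
  identity, and indices with equal digits are equal.\<close>

lemma sum_tensor_pauli_projector:
  assumes "a < 2 ^ n" "c < 2 ^ n"
  shows "(\<Sum>b | length b = n. tensor n (\<lambda>j. pauli_projector (p j) (b ! j)) $$ (a, c))
    = (if a = c then 1 else 0)"
proof -
  have "(\<Sum>b | length b = n. tensor n (\<lambda>j. pauli_projector (p j) (b ! j)) $$ (a, c))
      = (\<Prod>j<n. if a div 2 ^ j mod 2 = c div 2 ^ j mod 2 then 1 else 0)"
    using assms sum_bool_lists_prod[where n=n and f="\<lambda>j x. pauli_projector (p j) x $$ (a div 2 ^ j mod 2, c div 2 ^ j mod 2)"]
    by (simp add: tensor_def) (auto simp: pauli_projector_entry add_divide_distrib[symmetric] intro!: prod.cong)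
  also have "\<dots> = (if a = c then 1 else 0)"
    using bits_eq_iff[OF assms] by (auto intro!: prod.neutral)
  finally show ?thesis .
qed

section \<open>Evolution and the affinity of a shot\<close>

text \<open>This is the trace of E W \<rho> U^* with W = diag(w) and U = diag(u). For
  \<open>u = w\<close> it is an outcome probability after a diagonal evolution; for different
  \<open>u\<close> and \<open>w\<close> it is the cross term of two evolutions.\<close>

definition born :: "nat \<Rightarrow> complex mat \<Rightarrow> complex mat \<Rightarrow> (nat \<Rightarrow> complex) \<Rightarrow> (nat \<Rightarrow> complex) \<Rightarrow> complex"
  where "born d E \<rho> u w = (\<Sum>a<d. \<Sum>c<d. E $$ (a, c) * \<rho> $$ (c, a) * (w c * cnj (u a)))"

text \<open>With E = B B^* and \<rho> = A A^* the trace becomes the Hilbert-Schmidt inner product of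
  B^* W A and B^* U A, whose entries are \<open>s w\<close> and \<open>s u\<close>. Nonnegativity
  and Cauchy-Schwarz follow.\<close>

lemma born_gram:
  assumes "gram d E" "gram d \<rho>"
  obtains s where "\<And>u w. born d E \<rho> u w = (\<Sum>x\<in>{..<d} \<times> {..<d}. s w x * cnj (s u x))"
proof -
  obtain B where B: "\<And>a c. a < d \<Longrightarrow> c < d \<Longrightarrow> E $$ (a, c) = (\<Sum>m<d. B a m * cnj (B c m))"
    using assms(1) unfolding gram_def by blast
  obtain A where A: "\<And>a c. a < d \<Longrightarrow> c < d \<Longrightarrow> \<rho> $$ (a, c) = (\<Sum>m<d. A a m * cnj (A c m))"
    using assms(2) unfolding gram_def by blast
  define s where "s w x = (\<Sum>c<d. cnj (B c (fst x)) * A c (snd x) * w c)" for w :: "nat \<Rightarrow> complex" and x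
  have "born d E \<rho> u w = (\<Sum>x\<in>{..<d} \<times> {..<d}. s w x * cnj (s u x))" for u w
  proof -
    let ?t = "\<lambda>a c x. (cnj (B c (fst x)) * A c (snd x) * w c) * cnj (cnj (B a (fst x)) * A a (snd x) * u a)"
    have "born d E \<rho> u w = (\<Sum>a<d. \<Sum>c<d. \<Sum>x\<in>{..<d} \<times> {..<d}. ?t a c x)"
    proof -
      have "E $$ (a, c) * \<rho> $$ (c, a) * (w c * cnj (u a)) = (\<Sum>x\<in>{..<d} \<times> {..<d}. ?t a c x)"
        if "a < d" "c < d" for a c
      proof -
        have "E $$ (a, c) * \<rho> $$ (c, a) = (\<Sum>x\<in>{..<d} \<times> {..<d}.
            B a (fst x) * cnj (B c (fst x)) * (A c (snd x) * cnj (A a (snd x))))"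
          unfolding B[OF that] A[OF that(2) that(1)] sum_product sum.cartesian_product
          by (simp add: case_prod_unfold)
        then show ?thesis by (simp only: sum_distrib_right) (simp add: mult_ac)
      qed
      then show ?thesis unfolding born_def by (intro sum.cong) auto
    qed
    also have "\<dots> = (\<Sum>a<d. \<Sum>x\<in>{..<d} \<times> {..<d}. \<Sum>c<d. ?t a c x)"
      by (intro sum.cong refl sum.swap)
    also have "\<dots> = (\<Sum>x\<in>{..<d} \<times> {..<d}. \<Sum>a<d. \<Sum>c<d. ?t a c x)"
      by (rule sum.swap)
    also have "\<dots> = (\<Sum>x\<in>{..<d} \<times> {..<d}. s w x * cnj (s u x))"
      unfolding s_def cnj_sum sum_product by (intro sum.cong refl sum.swap)
    finally show ?thesis .
  qed
  then show ?thesis by (rule that)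
qed

lemma
  assumes "gram d E" "gram d \<rho>"
  shows born_nonneg: "0 \<le> Re (born d E \<rho> u u)"
    and born_Cauchy_Schwarz:
      "cmod (born d E \<rho> u w) \<le> sqrt (Re (born d E \<rho> u u) * Re (born d E \<rho> w w))"
proof -
  obtain s where s: "\<And>u w. born d E \<rho> u w = (\<Sum>x\<in>{..<d} \<times> {..<d}. s w x * cnj (s u x))"
    using born_gram[OF assms] by metis
  have diag: "Re (born d E \<rho> u u) = (\<Sum>x\<in>{..<d} \<times> {..<d}. (cmod (s u x))\<^sup>2)" for u
    by (simp add: s complex_mult_cnj cmod_power2)
  show "0 \<le> Re (born d E \<rho> u u)"
    unfolding diag by (intro sum_nonneg) auto
  have "cmod (born d E \<rho> u w) \<le> (\<Sum>x\<in>{..<d} \<times> {..<d}. cmod (s u x) * cmod (s w x))"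
    unfolding s by (rule order_trans[OF norm_sum]) (simp add: norm_mult mult.commute)
  moreover have "0 \<le> (\<Sum>x\<in>{..<d} \<times> {..<d}. cmod (s u x) * cmod (s w x))"
    by (intro sum_nonneg) auto
  ultimately have "(cmod (born d E \<rho> u w))\<^sup>2
      \<le> (\<Sum>x\<in>{..<d} \<times> {..<d}. cmod (s u x) * cmod (s w x))\<^sup>2"
    by (intro power_mono) auto
  also have "\<dots> \<le> Re (born d E \<rho> u u) * Re (born d E \<rho> w w)"
    unfolding diag by (rule Cauchy_Schwarz_ineq_sum)
  finally show "cmod (born d E \<rho> u w) \<le> sqrt (Re (born d E \<rho> u u) * Re (born d E \<rho> w w))"
    by (rule real_le_rsqrt)
qed

section \<open>Diagonal dynamics in the computational basis\<close>

definition parity_sign :: "nat \<Rightarrow> nat set \<Rightarrow> nat \<Rightarrow> real" where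
  "parity_sign n S a = (\<Prod>j<n. if j \<in> S \<and> a div 2 ^ j mod 2 = 1 then - 1 else 1)"

text \<open>The eigenvalue of \<open>hamiltonian\<close> at the basis state \<open>a\<close>: a
  polynomial on the cube whose monomials \<open>parity_sign n S\<close> are Walsh characters, the
  diagonals of \<open>Z_string n S\<close>.\<close>

definition energy :: "nat \<Rightarrow> nat \<Rightarrow> real \<Rightarrow> (nat set \<Rightarrow> real) \<Rightarrow> nat \<Rightarrow> real" where
  "energy n k \<delta> v a = \<delta> * (\<Sum>S\<in>nsets {..<n} k. v S * parity_sign n S a)"

lemma parity_sign_cases: "parity_sign n S a = 1 \<or> parity_sign n S a = - 1"
  unfolding parity_sign_def by (induction n) auto

lemma Z_string_entry:
  assumes "a < 2 ^ n" "b < 2 ^ n"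
  shows "Z_string n S $$ (a, b) = (if a = b then of_real (parity_sign n S a) else 0)"
proof -
  have *: "(if j \<in> S then pauli_mat PauliZ else 1\<^sub>m 2) $$ (a div 2 ^ j mod 2, b div 2 ^ j mod 2)
      = (if a div 2 ^ j mod 2 = b div 2 ^ j mod 2
         then if j \<in> S \<and> a div 2 ^ j mod 2 = 1 then - 1 else 1 else 0)" for j
    by (cases "a div 2 ^ j mod 2 = 0"; cases "b div 2 ^ j mod 2 = 0")
       (auto simp: mat_of_rows_list_def not_mod_2_eq_0_eq_1)
  show ?thesis
  proof (cases "a = b")
    case True
    then show ?thesis using assms * by (auto simp: Z_string_def tensor_def parity_sign_def intro!: prod.cong)
  next
    case False
    then obtain j where "j < n" "a div 2 ^ j mod 2 \<noteq> b div 2 ^ j mod 2"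
      using bits_eq_iff[OF assms] by auto
    then have "(if j \<in> S then pauli_mat PauliZ else 1\<^sub>m 2) $$ (a div 2 ^ j mod 2, b div 2 ^ j mod 2) = 0"
      unfolding * by auto
    then have "(\<Prod>j<n. (if j \<in> S then pauli_mat PauliZ else 1\<^sub>m 2)
        $$ (a div 2 ^ j mod 2, b div 2 ^ j mod 2)) = 0"
      using \<open>j < n\<close> by (intro prod_zero finite_lessThan bexI[of _ j]) simp_all
    then show ?thesis using assms False by (simp add: Z_string_def tensor_def)
  qed
qed

lemma index_mult_mat_sum:
  assumes "A \<in> carrier_mat m d" "B \<in> carrier_mat d p" "i < m" "j < p"
  shows "(A * B) $$ (i, j) = (\<Sum>c<d. A $$ (i, c) * B $$ (c, j))"
  using assms by (simp add: scalar_prod_def lessThan_atLeast0)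

lemma hamiltonian_carrier [simp]: "hamiltonian n k \<delta> v \<in> carrier_mat (2 ^ n) (2 ^ n)"
  by (simp add: hamiltonian_def)

lemma hamiltonian_entry:
  assumes "a < 2 ^ n" "b < 2 ^ n"
  shows "hamiltonian n k \<delta> v $$ (a, b) = (if a = b then of_real (energy n k \<delta> v a) else 0)"
  using assms by (simp add: hamiltonian_def energy_def Z_string_entry)

lemma generator_carrier:
  "\<rho> \<in> carrier_mat (2 ^ n) (2 ^ n) \<Longrightarrow> generator n k \<delta> v \<rho> \<in> carrier_mat (2 ^ n) (2 ^ n)"
  unfolding generator_def
  using hamiltonian_carrier[of n k \<delta> v] by (intro smult_carrier_mat minus_carrier_mat mult_carrier_mat) auto

text \<open>A commutator with a diagonal matrix rescales every entry separately, so powers and the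
  exponential series of the generator reduce to scalar ones.\<close>

lemma generator_entry:
  assumes \<rho>: "\<rho> \<in> carrier_mat (2 ^ n) (2 ^ n)" and ab: "a < 2 ^ n" "b < 2 ^ n"
  shows "generator n k \<delta> v \<rho> $$ (a, b)
    = - \<i> * of_real (energy n k \<delta> v a - energy n k \<delta> v b) * \<rho> $$ (a, b)"
proof -
  let ?H = "hamiltonian n k \<delta> v"
  have H: "?H \<in> carrier_mat (2 ^ n) (2 ^ n)" by simp
  have "(?H * \<rho>) $$ (a, b) = (\<Sum>c<2 ^ n. ?H $$ (a, c) * \<rho> $$ (c, b))"
    using H \<rho> ab by (intro index_mult_mat_sum)
  also have "\<dots> = (\<Sum>c<2 ^ n. if c = a then of_real (energy n k \<delta> v a) * \<rho> $$ (c, b) else 0)"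
    using ab by (intro sum.cong) (auto simp: hamiltonian_entry)
  finally have 1: "(?H * \<rho>) $$ (a, b) = of_real (energy n k \<delta> v a) * \<rho> $$ (a, b)"
    using ab by simp
  have "(\<rho> * ?H) $$ (a, b) = (\<Sum>c<2 ^ n. \<rho> $$ (a, c) * ?H $$ (c, b))"
    using H \<rho> ab by (intro index_mult_mat_sum)
  also have "\<dots> = (\<Sum>c<2 ^ n. if c = b then of_real (energy n k \<delta> v b) * \<rho> $$ (a, c) else 0)"
    using ab by (intro sum.cong) (auto simp: hamiltonian_entry)
  finally have 2: "(\<rho> * ?H) $$ (a, b) = of_real (energy n k \<delta> v b) * \<rho> $$ (a, b)"
    using ab by simp
  have "dim_row (\<rho> * ?H) = 2 ^ n" "dim_col (\<rho> * ?H) = 2 ^ n" "dim_row (?H * \<rho>) = 2 ^ n" "dim_col (?H * \<rho>) = 2 ^ n"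
    using carrier_matD[OF \<rho>] carrier_matD[OF H] by auto
  then show ?thesis
    unfolding generator_def using ab 1 2 by (simp add: algebra_simps)
qed

lemma generator_funpow_entry:
  assumes \<rho>: "\<rho> \<in> carrier_mat (2 ^ n) (2 ^ n)" and ab: "a < 2 ^ n" "b < 2 ^ n"
  shows "(generator n k \<delta> v ^^ m) \<rho> $$ (a, b)
    = (- \<i> * of_real (energy n k \<delta> v a - energy n k \<delta> v b)) ^ m * \<rho> $$ (a, b)"
proof (induction m)
  case 0
  then show ?case by simp
next
  case (Suc m)
  have "(generator n k \<delta> v ^^ m) \<rho> \<in> carrier_mat (2 ^ n) (2 ^ n)"
    using \<rho> by (induction m) (auto intro: generator_carrier)
  from generator_entry[OF this ab] Suc.IH show ?case by simp
qed

lemma evolve_generator_entry: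
  assumes \<rho>: "\<rho> \<in> carrier_mat (2 ^ n) (2 ^ n)" and ab: "a < 2 ^ n" "b < 2 ^ n"
  shows "evolve (2 ^ n) (generator n k \<delta> v) t \<rho> $$ (a, b)
    = \<rho> $$ (a, b) * (cis (- t * energy n k \<delta> v a) * cnj (cis (- t * energy n k \<delta> v b)))"
proof -
  define z where "z = - \<i> * of_real (energy n k \<delta> v a - energy n k \<delta> v b)"
  have "(\<lambda>m. (of_real t * z) ^ m /\<^sub>R fact m) sums exp (of_real t * z)"
    by (rule exp_converges)
  then have "(\<lambda>m. (of_real t * z) ^ m /\<^sub>R fact m * \<rho> $$ (a, b)) sums (exp (of_real t * z) * \<rho> $$ (a, b))"
    by (rule sums_mult2)
  moreover have "(of_real t * z) ^ m /\<^sub>R fact m * \<rho> $$ (a, b)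
      = of_real (t ^ m / fact m) * (generator n k \<delta> v ^^ m) \<rho> $$ (a, b)" for m
    unfolding generator_funpow_entry[OF \<rho> ab] z_def[symmetric]
    by (simp add: power_mult_distrib scaleR_conv_of_real field_simps)
  ultimately have "evolve (2 ^ n) (generator n k \<delta> v) t \<rho> $$ (a, b) = exp (of_real t * z) * \<rho> $$ (a, b)"
    using ab by (simp add: evolve_def sums_iff)
  also have "exp (of_real t * z) = cis (- t * energy n k \<delta> v a) * cnj (cis (- t * energy n k \<delta> v b))"
    by (simp add: cis_cnj cis_mult z_def) (simp add: cis_conv_exp algebra_simps)
  finally show ?thesis by (simp add: mult.commute)
qed

text \<open>The evolution multiplies the input by diagonal phases on both sides, and these phases
  are all that depends on the sign vector.\<close>

lemma shot_prob_born:
  "shot_prob n (generator n k \<delta> v) P h b = Re (born (2 ^ n)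
     (tensor n (\<lambda>j. pauli_projector (basis P h j) (b ! j))) (tensor n (input P h))
     (\<lambda>a. cis (- duration P h * energy n k \<delta> v a)) (\<lambda>a. cis (- duration P h * energy n k \<delta> v a)))"
proof -
  let ?E = "tensor n (\<lambda>j. pauli_projector (basis P h j) (b ! j))"
  let ?\<rho> = "evolve (2 ^ n) (generator n k \<delta> v) (duration P h) (tensor n (input P h))"
  have E: "?E \<in> carrier_mat (2 ^ n) (2 ^ n)" and \<rho>: "?\<rho> \<in> carrier_mat (2 ^ n) (2 ^ n)"
    by (simp_all add: tensor_def evolve_def)
  have "mat_trace (?E * ?\<rho>) = (\<Sum>a<2 ^ n. \<Sum>c<2 ^ n. ?E $$ (a, c) * ?\<rho> $$ (c, a))"
    using E by (auto simp: mat_trace_def intro!: sum.cong index_mult_mat_sum[OF E \<rho>])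
  also have "\<dots> = born (2 ^ n) ?E (tensor n (input P h))
     (\<lambda>a. cis (- duration P h * energy n k \<delta> v a)) (\<lambda>a. cis (- duration P h * energy n k \<delta> v a))"
    unfolding born_def
  proof (intro sum.cong refl)
    fix a c :: nat
    assume "a \<in> {..<2 ^ n}" "c \<in> {..<2 ^ n}"
    then have ac: "c < 2 ^ n" "a < 2 ^ n" by auto
    have "tensor n (input P h) \<in> carrier_mat (2 ^ n) (2 ^ n)"
      by (simp add: tensor_def)
    from evolve_generator_entry[OF this ac]
    show "?E $$ (a, c) * ?\<rho> $$ (c, a) = ?E $$ (a, c) * tensor n (input P h) $$ (c, a) *
        (cis (- duration P h * energy n k \<delta> v c) * cnj (cis (- duration P h * energy n k \<delta> v a)))"
      by (simp only: mult.assoc)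
  qed
  finally show ?thesis
    unfolding shot_prob_def by simp
qed


lemma shot_prob_nonneg:
  assumes "\<And>j. j < n \<Longrightarrow> density_operator 2 (input P h j)"
  shows "0 \<le> shot_prob n (generator n k \<delta> v) P h b"
  unfolding shot_prob_born
  by (intro born_nonneg gram_tensor gram_pauli_projector density_operator_2D(1) assms)

text \<open>Completeness removes the measurement bases. Equal phases give total probability one; the
  phases of two neighbours give the overlap that bounds the affinity.\<close>

lemma sum_born_tensor_pauli_projector:
  "(\<Sum>b | length b = n. born (2 ^ n) (tensor n (\<lambda>j. pauli_projector (p j) (b ! j))) \<rho> u w)
    = (\<Sum>a<2 ^ n. \<rho> $$ (a, a) * (w a * cnj (u a)))"
proof -
  let ?E = "\<lambda>b. tensor n (\<lambda>j. pauli_projector (p j) (b ! j))"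
  have "(\<Sum>b | length b = n. born (2 ^ n) (?E b) \<rho> u w)
      = (\<Sum>a<2 ^ n. \<Sum>c<2 ^ n. (\<Sum>b | length b = n. ?E b $$ (a, c)) * \<rho> $$ (c, a) * (w c * cnj (u a)))"
    unfolding born_def sum_distrib_right
    by (subst sum.swap, intro sum.cong refl, subst sum.swap) simp
  also have "\<dots> = (\<Sum>a<2 ^ n. \<Sum>c<2 ^ n. if c = a then \<rho> $$ (c, a) * (w c * cnj (u a)) else 0)"
    by (intro sum.cong refl) (simp add: sum_tensor_pauli_projector)
  finally show ?thesis by simp
qed

lemma sum_tensor_diag:
  assumes "\<And>j. j < n \<Longrightarrow> density_operator 2 (R j)"
  shows "(\<Sum>a<2 ^ n. tensor n R $$ (a, a)) = 1"
proof -
  have "(\<Sum>a<2 ^ n. tensor n R $$ (a, a)) = mat_trace (tensor n R)"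
    by (simp add: mat_trace_def tensor_def)
  also have "\<dots> = 1"
    unfolding mat_trace_tensor using assms by (intro prod.neutral) (simp add: density_operator_2D(2)[unfolded One_nat_def])
  finally show ?thesis .
qed

lemma sum_shot_prob:
  assumes "\<And>j. j < n \<Longrightarrow> density_operator 2 (input P h j)"
  shows "(\<Sum>b | length b = n. shot_prob n (generator n k \<delta> v) P h b) = 1"
proof -
  have "cis x * cnj (cis x) = 1" for x
    by (simp add: cis_cnj cis_mult)
  then show ?thesis
    unfolding shot_prob_born Re_sum[symmetric] sum_born_tensor_pauli_projector
    by (simp add: sum_tensor_diag[OF assms] del: Re_sum)
qed

lemma energy_flip:
  assumes "S \<in> nsets {..<n} k"
  shows "energy n k \<delta> (v(S := - v S)) a = energy n k \<delta> v a - 2 * \<delta> * v S * parity_sign n S a"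
proof -
  have fin: "finite (nsets {..<n} k)" by (simp add: finite_imp_finite_nsets)
  have 1: "(\<Sum>T\<in>nsets {..<n} k. (v(S := - v S)) T * parity_sign n T a)
      = - v S * parity_sign n S a + (\<Sum>T\<in>nsets {..<n} k - {S}. v T * parity_sign n T a)"
    by (subst sum.remove[OF fin assms]) (auto intro!: sum.cong)
  have 2: "(\<Sum>T\<in>nsets {..<n} k. v T * parity_sign n T a)
      = v S * parity_sign n S a + (\<Sum>T\<in>nsets {..<n} k - {S}. v T * parity_sign n T a)"
    by (subst sum.remove[OF fin assms]) auto
  show ?thesis unfolding energy_def 1 2 by (simp add: algebra_simps)
qed

text \<open>Summing \<open>sqrt (p q) \<ge> \<bar>tr (E V \<rho>)\<bar>\<close> over the measured projectors \<open>E\<close>, where the diagonal unitary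
  \<open>V\<close> relates the two evolutions.\<close>

lemma shot_affinity:
  assumes dens: "\<And>j. j < n \<Longrightarrow> density_operator 2 (input P h j)"
    and S: "S \<in> nsets {..<n} k" and v: "v S \<in> {- 1, 1}"
  shows "\<bar>cos (2 * \<delta> * duration P h)\<bar> \<le> (\<Sum>b | length b = n.
    sqrt (shot_prob n (generator n k \<delta> v) P h b * shot_prob n (generator n k \<delta> (v(S := - v S))) P h b))"
proof -
  let ?t = "duration P h" and ?\<rho> = "tensor n (input P h)"
  let ?E = "\<lambda>b. tensor n (\<lambda>j. pauli_projector (basis P h j) (b ! j))"
  let ?u = "\<lambda>v a. cis (- ?t * energy n k \<delta> v a)"
  let ?v' = "v(S := - v S)"
  have \<rho>: "gram (2 ^ n) ?\<rho>"
    by (intro gram_tensor density_operator_2D(1) dens)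
  \<comment> \<open>The relative phase has angle \<plusminus> \<open>2 * \<delta> * ?t\<close>, with
    a sign depending on \<open>a\<close>. Cosine is even, so the real part is the same at every
    \<open>a\<close> and factors out of the average over the input.\<close>
  have "Re (?u ?v' a * cnj (?u v a)) = cos (2 * \<delta> * ?t)" for a
  proof -
    have "?u ?v' a * cnj (?u v a) = cis (2 * \<delta> * ?t * (v S * parity_sign n S a))"
      unfolding cis_cnj cis_mult energy_flip[OF S] by (simp add: algebra_simps)
    moreover have "v S * parity_sign n S a = 1 \<or> v S * parity_sign n S a = - 1"
      using v parity_sign_cases[of n S a] by auto
    ultimately show ?thesis by auto
  qed
  then have "Re (\<Sum>a<2 ^ n. ?\<rho> $$ (a, a) * (?u ?v' a * cnj (?u v a)))
      = (\<Sum>a<2 ^ n. Re (?\<rho> $$ (a, a)) * cos (2 * \<delta> * ?t))"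
    unfolding Re_sum by (intro sum.cong refl) (subst gram_diag[OF \<rho>], auto)
  also have "\<dots> = Re (\<Sum>a<2 ^ n. ?\<rho> $$ (a, a)) * cos (2 * \<delta> * ?t)"
    by (simp add: sum_distrib_right)
  also have "\<dots> = cos (2 * \<delta> * ?t)"
    using sum_tensor_diag[OF dens] by simp
  finally have "\<bar>cos (2 * \<delta> * ?t)\<bar> = \<bar>Re (\<Sum>b | length b = n. born (2 ^ n) (?E b) ?\<rho> (?u v) (?u ?v'))\<bar>"
    unfolding sum_born_tensor_pauli_projector by simp
  also have "\<dots> \<le> cmod (\<Sum>b | length b = n. born (2 ^ n) (?E b) ?\<rho> (?u v) (?u ?v'))"
    by (rule abs_Re_le_cmod)
  also have "\<dots> \<le> (\<Sum>b | length b = n. cmod (born (2 ^ n) (?E b) ?\<rho> (?u v) (?u ?v')))"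
    by (rule norm_sum)
  also have "\<dots> \<le> (\<Sum>b | length b = n.
    sqrt (shot_prob n (generator n k \<delta> v) P h b * shot_prob n (generator n k \<delta> ?v') P h b))"
    unfolding shot_prob_born
    by (intro sum_mono born_Cauchy_Schwarz gram_tensor gram_pauli_projector \<rho>)
  finally show ?thesis .
qed

section \<open>Trace norm\<close>

lemma mat_adjoint_dim [simp]:
  "dim_row (mat_adjoint A) = dim_col A" "dim_col (mat_adjoint A) = dim_row A"
  by (simp_all add: mat_adjoint_def)

lemma mat_adjoint_index [simp]:
  "i < dim_col A \<Longrightarrow> j < dim_row A \<Longrightarrow> mat_adjoint A $$ (i, j) = conjugate (A $$ (j, i))"
  unfolding mat_adjoint_def by (subst mat_of_rows_index) simp_all

lemma mat_adjoint_carrier: "A \<in> carrier_mat m d \<Longrightarrow> mat_adjoint A \<in> carrier_mat d m"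
  by (intro carrier_matI) simp_all

lemma mat_trace_mult_commute:
  assumes "A \<in> carrier_mat d m" "B \<in> carrier_mat m d"
  shows "mat_trace (A * B) = mat_trace (B * A)"
proof -
  have "mat_trace (A * B) = (\<Sum>i<d. \<Sum>j<m. A $$ (i, j) * B $$ (j, i))"
    using assms by (simp add: mat_trace_def scalar_prod_def lessThan_atLeast0)
  also have "\<dots> = (\<Sum>j<m. \<Sum>i<d. B $$ (j, i) * A $$ (i, j))"
    by (subst sum.swap) (simp add: mult.commute)
  also have "\<dots> = mat_trace (B * A)"
    using assms by (simp add: mat_trace_def scalar_prod_def lessThan_atLeast0)
  finally show ?thesis .
qed

text \<open>Schur triangularization: the trace is invariant under similarity and the diagonal lists
  the eigenvalues with multiplicity.\<close>

lemma complex_eigenvalue_list: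
  assumes A: "(A :: complex mat) \<in> carrier_mat d d"
  obtains as where "char_poly A = (\<Prod>a\<leftarrow>as. [:- a, 1:])" "length as = d" "mat_trace A = sum_list as"
proof -
  obtain as where as: "char_poly A = (\<Prod>a\<leftarrow>as. [:- a, 1:])" "length as = d"
    using char_poly_factorized[OF A] by blast
  obtain B P Q where dec: "schur_decomposition A as = (B, P, Q)"
    by (cases "schur_decomposition A as") auto
  from schur_decomposition[OF A as(1) dec]
  have sim: "similar_mat_wit A B P Q" and diag: "diag_mat B = as" by auto
  note w = similar_mat_witD2[OF A sim]
  have "mat_trace A = mat_trace (P * (B * Q))"
    using w by (simp add: assoc_mult_mat[of P d d B d Q d])
  also have "\<dots> = mat_trace (B * Q * P)"
    using w by (intro mat_trace_mult_commute) auto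
  also have "\<dots> = mat_trace B"
    using w by (simp add: assoc_mult_mat[of B d d Q d P d])
  also have "\<dots> = sum_list as"
    unfolding diag[symmetric] diag_mat_def mat_trace_def
    by (simp add: sum_list_distinct_conv_sum_set lessThan_atLeast0)
  finally show ?thesis using as that by blast
qed

text \<open>Translates the multiplicities in \<open>trace_norm\<close> into repetitions in the
  eigenvalue list.\<close>

lemma order_prod_linear:
  "order z (\<Prod>a\<leftarrow>as. [:- a, 1 :: 'a::idom:]) = count_list as z"
proof (induction as)
  case (Cons a as)
  have nz: "(\<Prod>a\<leftarrow>as. [:- a, 1 :: 'a:]) \<noteq> 0"
    by (auto simp: prod_list_zero_iff)
  have "order z [:- a, 1:] = (if a = z then 1 else 0)"
    using order_power_n_n[of z 1] by (auto intro: order_0I)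
  then show ?case
    using Cons.IH nz by (simp add: order_mult del: mult_pCons_left)
qed simp

lemma sum_count_list:
  fixes f :: "'a \<Rightarrow> real"
  assumes "finite A" "set xs \<subseteq> A"
  shows "(\<Sum>x\<in>A. real (count_list xs x) * f x) = sum_list (map f xs)"
  using assms(2)
proof (induction xs)
  case (Cons y xs)
  have "(\<Sum>x\<in>A. real (count_list (y # xs) x) * f x)
      = (\<Sum>x\<in>A. real (count_list xs x) * f x + (if x = y then f x else 0))"
    by (intro sum.cong) (auto simp: algebra_simps)
  then show ?case using Cons assms(1) by (simp add: sum.distrib)
qed simp

text \<open>The squared Hilbert-Schmidt norm, through which entries and singular values are
  compared.\<close>

definition sqnorm :: "complex mat \<Rightarrow> real" where
  "sqnorm X = (\<Sum>i<dim_row X. \<Sum>j<dim_col X. (cmod (X $$ (i, j)))\<^sup>2)"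

lemma entry_le_sqnorm:
  assumes "i < dim_row X" "j < dim_col X"
  shows "(cmod (X $$ (i, j)))\<^sup>2 \<le> sqnorm X"
proof -
  have "(cmod (X $$ (i, j)))\<^sup>2 \<le> (\<Sum>j<dim_col X. (cmod (X $$ (i, j)))\<^sup>2)"
    by (rule member_le_sum) (use assms in auto)
  also have "\<dots> \<le> sqnorm X"
    unfolding sqnorm_def
    by (rule member_le_sum[of i _ "\<lambda>i. \<Sum>j<dim_col X. (cmod (X $$ (i, j)))\<^sup>2"])
       (use assms in \<open>auto intro: sum_nonneg\<close>)
  finally show ?thesis .
qed

text \<open>For an eigenvector \<open>v\<close>, pairing with \<open>v\<close> gives z |v|^2 = |X
  v|^2, named \<open>q\<close> and \<open>r\<close> in the proof.\<close>

lemma gram_eigenvalue_nonneg: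
  assumes X: "X \<in> carrier_mat d d" and ev: "eigenvalue (mat_adjoint X * X) z"
  shows "z = of_real (Re z)" and "0 \<le> Re z"
proof -
  let ?G = "mat_adjoint X * X"
  have G: "?G \<in> carrier_mat d d" using X mat_adjoint_carrier[OF X] by auto
  obtain v where v: "v \<in> carrier_vec d" "v \<noteq> 0\<^sub>v d" and Gv: "?G *\<^sub>v v = z \<cdot>\<^sub>v v"
    using ev G unfolding eigenvalue_def eigenvector_def by auto
  define q where "q = (\<Sum>i<d. (cmod (v $ i))\<^sup>2)"
  define r where "r = (\<Sum>c<d. (cmod ((X *\<^sub>v v) $ c))\<^sup>2)"
  have Xv: "X *\<^sub>v v \<in> carrier_vec d" using X v by auto
  have "z \<cdot>\<^sub>v v = mat_adjoint X *\<^sub>v (X *\<^sub>v v)"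
    unfolding Gv[symmetric] by (rule assoc_mult_mat_vec[OF mat_adjoint_carrier[OF X] X v(1)])
  then have *: "z * v $ i = (\<Sum>c<d. cnj (X $$ (c, i)) * (X *\<^sub>v v) $ c)" if "i < d" for i
  proof -
    have "(z \<cdot>\<^sub>v v) $ i = (mat_adjoint X *\<^sub>v (X *\<^sub>v v)) $ i"
      using \<open>z \<cdot>\<^sub>v v = _\<close> by simp
    also have "(mat_adjoint X *\<^sub>v (X *\<^sub>v v)) $ i = (\<Sum>c<d. mat_adjoint X $$ (i, c) * (X *\<^sub>v v) $ c)"
      using that X Xv by (simp add: mult_mat_vec_def scalar_prod_def lessThan_atLeast0)
    also have "\<dots> = (\<Sum>c<d. cnj (X $$ (c, i)) * (X *\<^sub>v v) $ c)"
      using that X by (intro sum.cong) auto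
    finally show ?thesis using that v by simp
  qed
  have "z * of_real q = (\<Sum>i<d. z * v $ i * cnj (v $ i))"
    unfolding q_def of_real_sum complex_norm_square by (simp add: sum_distrib_left mult.assoc)
  also have "\<dots> = (\<Sum>i<d. \<Sum>c<d. cnj (X $$ (c, i)) * (X *\<^sub>v v) $ c * cnj (v $ i))"
    by (intro sum.cong refl) (simp add: * sum_distrib_right)
  also have "\<dots> = (\<Sum>c<d. \<Sum>i<d. cnj (X $$ (c, i)) * (X *\<^sub>v v) $ c * cnj (v $ i))"
    by (rule sum.swap)
  also have "\<dots> = (\<Sum>c<d. (X *\<^sub>v v) $ c * cnj (\<Sum>i<d. X $$ (c, i) * v $ i))"
    by (intro sum.cong refl) (simp add: sum_distrib_left mult_ac)
  also have "\<dots> = (\<Sum>c<d. (X *\<^sub>v v) $ c * cnj ((X *\<^sub>v v) $ c))"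
    using X v by (intro sum.cong refl) (simp add: mult_mat_vec_def scalar_prod_def lessThan_atLeast0)
  also have "\<dots> = of_real r"
    unfolding r_def of_real_sum complex_norm_square ..
  finally have zq: "z * of_real q = of_real r" .
  have "\<exists>i<d. v $ i \<noteq> 0" using v by (metis eq_vecI carrier_vecD index_zero_vec)
  then have "q \<noteq> 0" unfolding q_def by (auto simp: sum_nonneg_eq_0_iff)
  moreover have "q \<ge> 0" "r \<ge> 0" unfolding q_def r_def by (auto intro: sum_nonneg)
  ultimately have "q > 0" by simp
  have "z = of_real (r / q)" using zq \<open>q > 0\<close> by (simp add: field_simps)
  then show "z = of_real (Re z)" "0 \<le> Re z" using \<open>q > 0\<close> \<open>r \<ge> 0\<close> by auto
qed

text \<open>Replaces the sum over the spectrum by a list with repetitions, so that norm comparisons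
  become inequalities about lists of nonnegative reals. Both sides of the last equation are the
  trace of X^* X.\<close>

lemma squared_singular_values:
  assumes X: "X \<in> carrier_mat d d"
  obtains ss where "length ss = d" "\<And>s. s \<in> set ss \<Longrightarrow> 0 \<le> s"
    "\<And>s. s \<in> set ss \<Longrightarrow> eigenvalue (mat_adjoint X * X) (of_real s)"
    "trace_norm X = sum_list (map sqrt ss)" "sum_list ss = sqnorm X"
proof -
  let ?G = "mat_adjoint X * X"
  have G: "?G \<in> carrier_mat d d" using X mat_adjoint_carrier[OF X] by auto
  obtain as where as: "char_poly ?G = (\<Prod>a\<leftarrow>as. [:- a, 1:])" "length as = d" "mat_trace ?G = sum_list as"
    using complex_eigenvalue_list[OF G] by blast
  have spec: "spectrum ?G = set as"
    unfolding spectrum_root_char_poly[OF G] as(1) by (auto simp: poly_prod_list prod_list_zero_iff o_def)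
  then have ev: "eigenvalue ?G a" if "a \<in> set as" for a
    using that by (auto simp: spectrum_def)
  note nn = gram_eigenvalue_nonneg[OF X ev]
  have "trace_norm X = sum_list (map (\<lambda>a. sqrt (Re a)) as)"
    unfolding trace_norm_def Let_def spec as(1) order_prod_linear
    by (rule sum_count_list) auto
  moreover have "sum_list (map Re as) = sqnorm X"
  proof -
    have "sum_list (map Re as) = Re (mat_trace ?G)"
      unfolding as(3) by (induction as) auto
    also have "mat_trace ?G = (\<Sum>i<d. \<Sum>c<d. X $$ (c, i) * cnj (X $$ (c, i)))"
      using X by (simp add: mat_trace_def scalar_prod_def lessThan_atLeast0 mult.commute)
    also have "Re \<dots> = (\<Sum>i<d. \<Sum>c<d. (cmod (X $$ (c, i)))\<^sup>2)"
      by (simp add: complex_mult_cnj cmod_power2)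
    also have "\<dots> = sqnorm X"
      unfolding sqnorm_def using X by (subst sum.swap) simp
    finally show ?thesis .
  qed
  moreover have "eigenvalue ?G (of_real s)" if "s \<in> set (map Re as)" for s
    using that ev nn(1) by auto
  ultimately show ?thesis
    using that[of "map Re as"] as(2) nn(2) by (auto simp: o_def)
qed

text \<open>The l2 norm of the singular values is at most their l1 norm, because the mixed terms of
  the squared sum are nonnegative.\<close>

lemma sqnorm_le_trace_norm:
  assumes "X \<in> carrier_mat d d"
  shows "sqnorm X \<le> (trace_norm X)\<^sup>2" and "0 \<le> trace_norm X"
proof -
  obtain ss where ss: "\<And>s. s \<in> set ss \<Longrightarrow> 0 \<le> s"
    "trace_norm X = sum_list (map sqrt ss)" "sum_list ss = sqnorm X"
    using squared_singular_values[OF assms] by metis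
  have "0 \<le> sum_list (map sqrt ss) \<and> sum_list ss \<le> (sum_list (map sqrt ss))\<^sup>2"
    using ss(1)
  proof (induction ss)
    case (Cons s ss)
    then have IH: "0 \<le> sum_list (map sqrt ss)" "sum_list ss \<le> (sum_list (map sqrt ss))\<^sup>2" and s: "0 \<le> s"
      by auto
    have "(sum_list (map sqrt (s # ss)))\<^sup>2
        = s + (sum_list (map sqrt ss))\<^sup>2 + 2 * sqrt s * sum_list (map sqrt ss)"
      using s by (simp add: power2_sum)
    moreover have "0 \<le> 2 * sqrt s * sum_list (map sqrt ss)" using IH(1) s by simp
    ultimately have "sum_list (s # ss) \<le> (sum_list (map sqrt (s # ss)))\<^sup>2" using IH(2) by simp
    then show ?case using IH(1) s by simp
  qed simp
  then show "sqnorm X \<le> (trace_norm X)\<^sup>2" "0 \<le> trace_norm X" using ss by auto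
qed

text \<open>Crude, from sqrt s \<le> 1 + s; it serves only to show that the supremum in
  \<open>diamond_norm\<close> is finite.\<close>

lemma trace_norm_le_sqnorm:
  assumes "X \<in> carrier_mat d d"
  shows "trace_norm X \<le> real d + sqnorm X"
proof -
  obtain ss where ss: "length ss = d" "\<And>s. s \<in> set ss \<Longrightarrow> 0 \<le> s"
    "trace_norm X = sum_list (map sqrt ss)" "sum_list ss = sqnorm X"
    using squared_singular_values[OF assms] by metis
  have "sum_list (map sqrt ss) \<le> real (length ss) + sum_list ss"
    using ss(2)
  proof (induction ss)
    case (Cons s ss)
    have "sqrt s \<le> 1 + s"
      using Cons.prems[of s] by (intro real_le_lsqrt) (auto simp: power2_sum)
    then show ?case using Cons by auto
  qed simp
  then show ?thesis using ss by simp
qed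

text \<open>The eigenvalues of an idempotent are 0 and 1, and the square root fixes both.\<close>

lemma trace_norm_partial_isometry:
  assumes X: "X \<in> carrier_mat d d" and idem: "mat_adjoint X * X * (mat_adjoint X * X) = mat_adjoint X * X"
  shows "trace_norm X = sqnorm X"
proof -
  let ?G = "mat_adjoint X * X"
  have G: "?G \<in> carrier_mat d d" using X mat_adjoint_carrier[OF X] by auto
  obtain ss where ss: "\<And>s. s \<in> set ss \<Longrightarrow> eigenvalue ?G (of_real s)"
    "trace_norm X = sum_list (map sqrt ss)" "sum_list ss = sqnorm X"
    using squared_singular_values[OF X] by metis
  have "sqrt s = s" if s: "s \<in> set ss" for s
  proof -
    obtain v where v: "v \<in> carrier_vec d" "v \<noteq> 0\<^sub>v d" and Gv: "?G *\<^sub>v v = of_real s \<cdot>\<^sub>v v"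
      using ss(1)[OF s] G unfolding eigenvalue_def eigenvector_def by auto
    have "?G *\<^sub>v v = ?G *\<^sub>v (?G *\<^sub>v v)"
      using assoc_mult_mat_vec[OF G G v(1)] unfolding idem .
    then have eq: "of_real s \<cdot>\<^sub>v v = of_real s \<cdot>\<^sub>v (of_real s \<cdot>\<^sub>v v)"
      unfolding Gv mult_mat_vec[OF G v(1)] .
    obtain i where i: "i < d" "v $ i \<noteq> 0" using v by (metis eq_vecI carrier_vecD index_zero_vec)
    from arg_cong[OF eq, of "\<lambda>w. w $ i"] have "complex_of_real s = of_real s * of_real s"
      using i v by simp
    then have "s = s * s" by (metis of_real_mult of_real_eq_iff)
    then have "s = 0 \<or> s = 1" by simp
    then show ?thesis by auto
  qed
  then have "map sqrt ss = ss" by (simp add: map_idI)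
  then show ?thesis using ss by simp
qed

definition matrix_unit :: "nat \<Rightarrow> nat \<Rightarrow> nat \<Rightarrow> complex mat" where
  "matrix_unit d a b = mat d d (\<lambda>ij. if ij = (a, b) then 1 else 0)"

lemma matrix_unit_carrier [simp]: "matrix_unit d a b \<in> carrier_mat d d"
  by (simp add: matrix_unit_def)

text \<open>Makes matrix units admissible inputs in the supremum defining the diamond norm.\<close>

lemma trace_norm_matrix_unit:
  assumes "a < d" "b < d"
  shows "trace_norm (matrix_unit d a b) = 1"
proof -
  let ?X = "matrix_unit d a b"
  have G: "mat_adjoint ?X * ?X = matrix_unit d b b"
  proof (rule eq_matI)
    fix i j assume "i < dim_row (matrix_unit d b b)" "j < dim_col (matrix_unit d b b)"
    then have ij: "i < d" "j < d" by (auto simp: matrix_unit_def)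
    have "(mat_adjoint ?X * ?X) $$ (i, j) = (\<Sum>c<d. cnj (?X $$ (c, i)) * ?X $$ (c, j))"
      using ij by (simp add: scalar_prod_def lessThan_atLeast0 matrix_unit_def)
    also have "\<dots> = (\<Sum>c<d. if c = a then (if i = b \<and> j = b then 1 else 0) else 0)"
      using ij by (intro sum.cong) (auto simp: matrix_unit_def)
    also have "\<dots> = matrix_unit d b b $$ (i, j)"
      using ij assms by (simp add: matrix_unit_def)
    finally show "(mat_adjoint ?X * ?X) $$ (i, j) = matrix_unit d b b $$ (i, j)" .
  qed (auto simp: matrix_unit_def)
  have "matrix_unit d b b * matrix_unit d b b = matrix_unit d b b"
  proof (rule eq_matI)
    fix i j assume "i < dim_row (matrix_unit d b b)" "j < dim_col (matrix_unit d b b)"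
    then have ij: "i < d" "j < d" by (auto simp: matrix_unit_def)
    have "(matrix_unit d b b * matrix_unit d b b) $$ (i, j)
        = (\<Sum>c<d. matrix_unit d b b $$ (i, c) * matrix_unit d b b $$ (c, j))"
      using ij by (simp add: scalar_prod_def lessThan_atLeast0 matrix_unit_def)
    also have "\<dots> = (\<Sum>c<d. if c = b then (if i = b \<and> j = b then 1 else 0) else 0)"
      using ij by (intro sum.cong) (auto simp: matrix_unit_def)
    also have "\<dots> = matrix_unit d b b $$ (i, j)"
      using ij assms by (simp add: matrix_unit_def)
    finally show "(matrix_unit d b b * matrix_unit d b b) $$ (i, j) = matrix_unit d b b $$ (i, j)" .
  qed (auto simp: matrix_unit_def)
  then have "trace_norm ?X = sqnorm ?X"
    using trace_norm_partial_isometry[of ?X d] by (simp add: G)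
  also have "\<dots> = (\<Sum>i<d. \<Sum>j<d. if j = b then (if i = a then 1 else 0) else 0)"
    unfolding sqnorm_def by (intro sum.cong) (auto simp: matrix_unit_def)
  also have "\<dots> = 1"
    using assms by simp
  finally show ?thesis .
qed

section \<open>Diamond norm and separation of the generators\<close>

text \<open>Finite dimension: the images of the finitely many matrix units control every
  image.\<close>

lemma superoperator_bounded:
  assumes \<Phi>: "superoperator d \<Phi>"
  obtains C where "0 \<le> C" "\<And>X i j. X \<in> carrier_mat d d \<Longrightarrow>
    (\<And>k l. k < d \<Longrightarrow> l < d \<Longrightarrow> cmod (X $$ (k, l)) \<le> 1) \<Longrightarrow> i < d \<Longrightarrow> j < d \<Longrightarrow> cmod (\<Phi> X $$ (i, j)) \<le> C"
proof -
  have car: "\<Phi> X \<in> carrier_mat d d" if "X \<in> carrier_mat d d" for X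
    using \<Phi> that unfolding superoperator_def by blast
  have add: "\<Phi> (X + Y) = \<Phi> X + \<Phi> Y" if "X \<in> carrier_mat d d" "Y \<in> carrier_mat d d" for X Y
    using \<Phi> that unfolding superoperator_def by blast
  have scale: "\<Phi> (c \<cdot>\<^sub>m X) = c \<cdot>\<^sub>m \<Phi> X" if "X \<in> carrier_mat d d" for c X
    using \<Phi> that unfolding superoperator_def by blast
  \<comment> \<open>Here \<open>S\<close> is the set of positions where \<open>X\<close> may be
    nonzero; the induction adds one position, hence one matrix unit, at a time.\<close>
  have "\<exists>C\<ge>0. \<forall>X\<in>carrier_mat d d. (\<forall>k<d. \<forall>l<d. cmod (X $$ (k, l)) \<le> 1) \<longrightarrow>
      (\<forall>k<d. \<forall>l<d. (k, l) \<notin> S \<longrightarrow> X $$ (k, l) = 0) \<longrightarrow> (\<forall>i<d. \<forall>j<d. cmod (\<Phi> X $$ (i, j)) \<le> C)"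
    if "finite S" "S \<subseteq> {..<d} \<times> {..<d}" for S
    using that
  proof (induction S)
    case empty
    show ?case
    proof (intro exI[of _ 0] conjI ballI impI allI)
      fix X :: "complex mat" and i j
      assume X: "X \<in> carrier_mat d d" "\<forall>k<d. \<forall>l<d. (k, l) \<notin> {} \<longrightarrow> X $$ (k, l) = 0" and ij: "i < d" "j < d"
      have "X = 0 \<cdot>\<^sub>m X" using X by (intro eq_matI) auto
      then have "\<Phi> X = 0 \<cdot>\<^sub>m \<Phi> X" using scale[OF X(1)] by metis
      then have "\<Phi> X $$ (i, j) = (0 \<cdot>\<^sub>m \<Phi> X) $$ (i, j)" by simp
      also have "\<dots> = 0" using car[OF X(1)] ij by simp
      finally show "cmod (\<Phi> X $$ (i, j)) \<le> 0" by simp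
    qed simp
  next
    case (insert p S)
    obtain a b where p: "p = (a, b)" and ab: "a < d" "b < d" using insert.prems by (cases p) auto
    obtain C where C: "C \<ge> 0" "\<And>X i j. X \<in> carrier_mat d d \<Longrightarrow> (\<forall>k<d. \<forall>l<d. cmod (X $$ (k, l)) \<le> 1) \<Longrightarrow>
      (\<forall>k<d. \<forall>l<d. (k, l) \<notin> S \<longrightarrow> X $$ (k, l) = 0) \<Longrightarrow> i < d \<Longrightarrow> j < d \<Longrightarrow> cmod (\<Phi> X $$ (i, j)) \<le> C"
      using insert.IH insert.prems by auto
    let ?U = "matrix_unit d a b"
    define C' where "C' = (\<Sum>i<d. \<Sum>j<d. cmod (\<Phi> ?U $$ (i, j)))"
    have C': "cmod (\<Phi> ?U $$ (i, j)) \<le> C'" if "i < d" "j < d" for i j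
    proof -
      have "cmod (\<Phi> ?U $$ (i, j)) \<le> (\<Sum>j<d. cmod (\<Phi> ?U $$ (i, j)))"
        by (rule member_le_sum) (use that in auto)
      also have "\<dots> \<le> C'"
        unfolding C'_def by (rule member_le_sum[of i _ "\<lambda>i. \<Sum>j<d. cmod (\<Phi> ?U $$ (i, j))"])
          (use that in \<open>auto intro: sum_nonneg\<close>)
      finally show ?thesis .
    qed
    have "0 \<le> C'" unfolding C'_def by (intro sum_nonneg) auto
    show ?case
    proof (intro exI[of _ "C + C'"] conjI ballI impI allI)
      fix X :: "complex mat" and i j
      assume X: "X \<in> carrier_mat d d" and le: "\<forall>k<d. \<forall>l<d. cmod (X $$ (k, l)) \<le> 1"
        and out: "\<forall>k<d. \<forall>l<d. (k, l) \<notin> insert p S \<longrightarrow> X $$ (k, l) = 0" and ij: "i < d" "j < d"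
      define Y where "Y = mat d d (\<lambda>ij. if ij = p then 0 else X $$ ij)"
      have Y: "Y \<in> carrier_mat d d" by (simp add: Y_def)
      have "X = Y + X $$ (a, b) \<cdot>\<^sub>m ?U"
        using X by (intro eq_matI) (auto simp: Y_def p matrix_unit_def)
      then have "\<Phi> X = \<Phi> Y + X $$ (a, b) \<cdot>\<^sub>m \<Phi> ?U"
        using add[of Y "X $$ (a, b) \<cdot>\<^sub>m ?U"] scale[of ?U] Y by simp
      then have "\<Phi> X $$ (i, j) = \<Phi> Y $$ (i, j) + X $$ (a, b) * \<Phi> ?U $$ (i, j)"
        using car[of ?U] car[OF Y] ij by simp
      then have "cmod (\<Phi> X $$ (i, j)) \<le> cmod (\<Phi> Y $$ (i, j)) + cmod (X $$ (a, b)) * cmod (\<Phi> ?U $$ (i, j))"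
        using norm_triangle_ineq by (simp add: norm_mult[symmetric])
      moreover have "cmod (\<Phi> Y $$ (i, j)) \<le> C"
        using le out by (intro C(2) Y ij) (auto simp: Y_def)
      moreover have "cmod (X $$ (a, b)) * cmod (\<Phi> ?U $$ (i, j)) \<le> 1 * C'"
        using le ab ij C' by (intro mult_mono) auto
      ultimately show "cmod (\<Phi> X $$ (i, j)) \<le> C + C'" by simp
    qed (use C \<open>0 \<le> C'\<close> in auto)
  qed
  from this[of "{..<d} \<times> {..<d}"] show ?thesis
    using that by auto
qed

text \<open>A real supremum dominates its set only if the set is bounded above. The proof supplies
  some bound; its size is irrelevant.\<close>

lemma trace_norm_tensor_id_le_diamond_norm:
  assumes \<Phi>: "superoperator d \<Phi>" and X: "X \<in> carrier_mat (d * d) (d * d)" "trace_norm X \<le> 1"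
  shows "trace_norm (tensor_id d d \<Phi> X) \<le> diamond_norm d \<Phi>"
proof -
  obtain C where C: "0 \<le> C" "\<And>X i j. X \<in> carrier_mat d d \<Longrightarrow>
    (\<And>k l. k < d \<Longrightarrow> l < d \<Longrightarrow> cmod (X $$ (k, l)) \<le> 1) \<Longrightarrow> i < d \<Longrightarrow> j < d \<Longrightarrow> cmod (\<Phi> X $$ (i, j)) \<le> C"
    using superoperator_bounded[OF \<Phi>] by metis
  have "trace_norm (tensor_id d d \<Phi> Y) \<le> real (d * d) + real (d * d) * real (d * d) * C\<^sup>2"
    if Y: "Y \<in> carrier_mat (d * d) (d * d)" "trace_norm Y \<le> 1" for Y
  proof -
    have "(trace_norm Y)\<^sup>2 \<le> 1"
      using sqnorm_le_trace_norm(2)[OF Y(1)] Y(2) by (simp add: power_le_one)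
    then have sq1: "sqnorm Y \<le> 1"
      using sqnorm_le_trace_norm(1)[OF Y(1)] by linarith
    have Y1: "cmod (Y $$ (r, s)) \<le> 1" if "r < d * d" "s < d * d" for r s
    proof -
      have "(cmod (Y $$ (r, s)))\<^sup>2 \<le> 1\<^sup>2"
        using entry_le_sqnorm[of r Y s] that Y(1) sq1 by simp
      then show ?thesis by (rule power2_le_imp_le) simp
    qed
    have T: "tensor_id d d \<Phi> Y \<in> carrier_mat (d * d) (d * d)" by (simp add: tensor_id_def)
    have "cmod (tensor_id d d \<Phi> Y $$ (r, s)) \<le> C" if rs: "r < d * d" "s < d * d" for r s
    proof -
      have pos: "0 < d" using rs by (cases d) auto
      have "k * d + r mod d < d * d" if "k < d" for k r
      proof -
        have "k * d + r mod d < k * d + d" using pos by simp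
        also have "\<dots> = Suc k * d" by simp
        also have "\<dots> \<le> d * d" using that by (intro mult_le_mono1) simp
        finally show ?thesis .
      qed
      then have "cmod (\<Phi> (mat d d (\<lambda>(i, j). Y $$ (i * d + r mod d, j * d + s mod d))) $$ (r div d, s div d)) \<le> C"
        using rs Y1 by (intro C(2)) (auto simp: less_mult_imp_div_less)
      then show ?thesis using rs by (simp add: tensor_id_def)
    qed
    then have "(cmod (tensor_id d d \<Phi> Y $$ (r, s)))\<^sup>2 \<le> C\<^sup>2" if "r < d * d" "s < d * d" for r s
      using that by (intro power_mono) auto
    then have "(\<Sum>r<d * d. \<Sum>s<d * d. (cmod (tensor_id d d \<Phi> Y $$ (r, s)))\<^sup>2)
        \<le> (\<Sum>r<d * d. \<Sum>s<d * d. C\<^sup>2)"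
      by (intro sum_mono) simp
    then have "sqnorm (tensor_id d d \<Phi> Y) \<le> real (d * d) * real (d * d) * C\<^sup>2"
      unfolding sqnorm_def carrier_matD[OF T] by (simp add: mult.assoc)
    then show ?thesis
      using trace_norm_le_sqnorm[OF T] by simp
  qed
  then have "bdd_above ((\<lambda>X. trace_norm (tensor_id d d \<Phi> X)) `
      {X \<in> carrier_mat (d * d) (d * d). trace_norm X \<le> 1})"
    by (intro bdd_aboveI) auto
  then show ?thesis
    unfolding diamond_norm_def using X by (intro cSUP_upper) auto
qed

lemma entry_le_diamond_norm:
  assumes \<Phi>: "superoperator d \<Phi>" and ab: "a < d" "b < d"
  shows "cmod (\<Phi> (matrix_unit d a b) $$ (a, b)) \<le> diamond_norm d \<Phi>"
proof -
  let ?X = "matrix_unit (d * d) (a * d) (b * d)"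
  let ?T = "tensor_id d d \<Phi> ?X"
  have pos: "0 < d" using ab by simp
  have less: "a * d < d * d" "b * d < d * d" using ab pos by simp_all
  have T: "?T \<in> carrier_mat (d * d) (d * d)" by (simp add: tensor_id_def)
  have block: "mat d d (\<lambda>(i, j). ?X $$ (i * d, j * d)) = matrix_unit d a b"
    using pos by (intro eq_matI) (auto simp: matrix_unit_def)
  have "?T $$ (a * d, b * d) = \<Phi> (mat d d (\<lambda>(i, j). ?X $$ (i * d, j * d))) $$ (a, b)"
    using less pos by (simp add: tensor_id_def)
  then have "(cmod (\<Phi> (matrix_unit d a b) $$ (a, b)))\<^sup>2 \<le> sqnorm ?T"
    using entry_le_sqnorm[of "a * d" ?T "b * d"] T less by (simp add: block)
  also have "\<dots> \<le> (trace_norm ?T)\<^sup>2"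
    by (rule sqnorm_le_trace_norm(1)[OF T])
  finally have "cmod (\<Phi> (matrix_unit d a b) $$ (a, b)) \<le> trace_norm ?T"
    using sqnorm_le_trace_norm(2)[OF T] by (rule power2_le_imp_le)
  also have "\<dots> \<le> diamond_norm d \<Phi>"
    using trace_norm_matrix_unit[OF less] by (intro trace_norm_tensor_id_le_diamond_norm \<Phi>) auto
  finally show ?thesis .
qed

lemma superoperator_diff:
  assumes "superoperator d \<Phi>" "superoperator d \<Psi>"
  shows "superoperator d (\<lambda>X. \<Phi> X - \<Psi> X)"
proof -
  have car: "\<Phi> X \<in> carrier_mat d d" "\<Psi> X \<in> carrier_mat d d" if "X \<in> carrier_mat d d" for X
    using assms that unfolding superoperator_def by blast+
  have "\<Phi> (X + Y) - \<Psi> (X + Y) = (\<Phi> X - \<Psi> X) + (\<Phi> Y - \<Psi> Y)"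
    if X: "X \<in> carrier_mat d d" and Y: "Y \<in> carrier_mat d d" for X Y
  proof -
    have "\<Phi> (X + Y) - \<Psi> (X + Y) = (\<Phi> X + \<Phi> Y) - (\<Psi> X + \<Psi> Y)"
      using assms X Y unfolding superoperator_def by simp
    also have "\<dots> = (\<Phi> X - \<Psi> X) + (\<Phi> Y - \<Psi> Y)"
      using car[OF X] car[OF Y] by (intro eq_matI) auto
    finally show ?thesis .
  qed
  moreover have "\<Phi> (c \<cdot>\<^sub>m X) - \<Psi> (c \<cdot>\<^sub>m X) = c \<cdot>\<^sub>m (\<Phi> X - \<Psi> X)"
    if X: "X \<in> carrier_mat d d" for c X
  proof -
    have "\<Phi> (c \<cdot>\<^sub>m X) - \<Psi> (c \<cdot>\<^sub>m X) = c \<cdot>\<^sub>m \<Phi> X - c \<cdot>\<^sub>m \<Psi> X"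
      using assms X unfolding superoperator_def by simp
    also have "\<dots> = c \<cdot>\<^sub>m (\<Phi> X - \<Psi> X)"
      using car[OF X] by (intro eq_matI) (auto simp: algebra_simps)
    finally show ?thesis .
  qed
  ultimately show ?thesis unfolding superoperator_def using car by (auto intro: minus_carrier_mat)
qed

lemma superoperator_generator: "superoperator (2 ^ n) (generator n k \<delta> v)"
proof -
  note car = generator_carrier[of _ n k \<delta> v]
  have "generator n k \<delta> v (X + Y) = generator n k \<delta> v X + generator n k \<delta> v Y"
    if X: "X \<in> carrier_mat (2 ^ n) (2 ^ n)" and Y: "Y \<in> carrier_mat (2 ^ n) (2 ^ n)" for X Y
  proof -
    have XY: "X + Y \<in> carrier_mat (2 ^ n) (2 ^ n)" using X Y by simp
    show ?thesis
      using car[OF X] car[OF Y] car[OF XY] X Y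
      by (intro eq_matI) (auto simp: generator_entry[OF X] generator_entry[OF Y] generator_entry[OF XY] algebra_simps)
  qed
  moreover have "generator n k \<delta> v (c \<cdot>\<^sub>m X) = c \<cdot>\<^sub>m generator n k \<delta> v X"
    if X: "X \<in> carrier_mat (2 ^ n) (2 ^ n)" for c X
  proof -
    have cX: "c \<cdot>\<^sub>m X \<in> carrier_mat (2 ^ n) (2 ^ n)" using X by simp
    show ?thesis
      using car[OF X] car[OF cX] X
      by (intro eq_matI) (auto simp: generator_entry[OF X] generator_entry[OF cX] algebra_simps)
  qed
  ultimately show ?thesis unfolding superoperator_def using car by auto
qed

section \<open>Fourier analysis of the energies on the cube\<close>

lemma sum_parity_sign_mult:
  assumes "S \<subseteq> {..<n}" "T \<subseteq> {..<n}"
  shows "(\<Sum>a<2 ^ n. parity_sign n S a * parity_sign n T a) = (if S = T then 2 ^ n else 0)"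
proof -
  have "(\<Sum>a<2 ^ n. parity_sign n S a * parity_sign n T a)
      = (\<Prod>j<n. 1 + (if j \<in> S then - 1 else 1) * (if j \<in> T then - 1 else (1 :: real)))"
    using sum_bits_prod[where n = n and f = "\<lambda>j i. (if j \<in> S \<and> i = 1 then - 1 else 1) * (if j \<in> T \<and> i = 1 then - 1 else (1 :: real))"]
    by (simp add: parity_sign_def prod.distrib)
  also have "\<dots> = (if S = T then 2 ^ n else 0)"
  proof (cases "S = T")
    case True
    then have "(\<Prod>j<n. 1 + (if j \<in> S then - 1 else 1) * (if j \<in> T then - 1 else (1 :: real))) = (\<Prod>j<n. 2)"
      by (intro prod.cong) auto
    then show ?thesis using True by simp
  next
    case False
    \<comment> \<open>A qubit in exactly one of the two sets contributes the factor 1 - 1 =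
      0.\<close>
    then obtain j where "j < n" "(j \<in> S) \<noteq> (j \<in> T)" using assms by blast
    then have "(\<Prod>j<n. 1 + (if j \<in> S then - 1 else 1) * (if j \<in> T then - 1 else (1 :: real))) = 0"
      by (intro prod_zero bexI[of _ j]) auto
    then show ?thesis using False by simp
  qed
  finally show ?thesis .
qed

text \<open>Orthogonality to the constant character. For \<open>k = 0\<close> the only term would be
  a multiple of the identity, which no commutator detects.\<close>

lemma sum_energy:
  assumes "1 \<le> k"
  shows "(\<Sum>a<2 ^ n. energy n k \<delta> v a) = 0"
proof -
  have "(\<Sum>a<2 ^ n. parity_sign n S a) = 0" if "S \<in> nsets {..<n} k" for S
    using sum_parity_sign_mult[of S n "{}"] that assms
    by (auto simp: nsets_def parity_sign_def[of n "{}"] split: if_splits)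
  then have "(\<Sum>S\<in>nsets {..<n} k. v S * (\<Sum>a<2 ^ n. parity_sign n S a)) = 0"
    by (intro sum.neutral) auto
  then show ?thesis
    unfolding energy_def sum_distrib_left[symmetric]
    by (subst sum.swap) (simp add: sum_distrib_left)
qed

text \<open>Parseval's identity for the Walsh characters.\<close>

lemma sum_energy_square:
  "(\<Sum>a<2 ^ n. (energy n k \<delta> v a)\<^sup>2) = 2 ^ n * \<delta>\<^sup>2 * (\<Sum>S\<in>nsets {..<n} k. (v S)\<^sup>2)"
proof -
  let ?I = "nsets {..<n} k"
  have fin: "finite ?I" by (simp add: finite_imp_finite_nsets)
  have "(\<Sum>a<2 ^ n. (\<Sum>S\<in>?I. v S * parity_sign n S a)\<^sup>2)
      = (\<Sum>a<2 ^ n. \<Sum>S\<in>?I. \<Sum>T\<in>?I. v S * v T * (parity_sign n S a * parity_sign n T a))"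
    unfolding power2_eq_square sum_product by (intro sum.cong refl) (simp add: mult_ac)
  also have "\<dots> = (\<Sum>S\<in>?I. \<Sum>T\<in>?I. \<Sum>a<2 ^ n. v S * v T * (parity_sign n S a * parity_sign n T a))"
    by (subst sum.swap, intro sum.cong refl, rule sum.swap)
  also have "\<dots> = (\<Sum>S\<in>?I. \<Sum>T\<in>?I. if T = S then v S * v T * 2 ^ n else 0)"
    unfolding sum_distrib_left[symmetric]
    by (intro sum.cong refl) (auto simp: sum_parity_sign_mult nsets_def)
  also have "\<dots> = (\<Sum>S\<in>?I. (v S)\<^sup>2 * 2 ^ n)"
    using fin by (simp add: power2_eq_square)
  finally show ?thesis
    unfolding energy_def power_mult_distrib sum_distrib_left[symmetric]
    by (simp add: sum_distrib_right mult_ac flip: sum_distrib_left)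
qed

lemma energy_diff: "energy n k \<delta> v a - energy n k \<delta> w a = energy n k \<delta> (\<lambda>S. v S - w S) a"
  unfolding energy_def by (simp add: left_diff_distrib right_diff_distrib sum_subtractf)

text \<open>Testing on the matrix unit at \<open>(a, b)\<close> reads off the energy gap between \<open>a\<close> and \<open>b\<close>. The energies
  average to zero over the cube, so all gaps at most \<open>2 \<epsilon>\<close> force the mean square energy, which
  counts the sign disagreements by orthogonality of the parity characters, to be at most \<open>4 \<epsilon>\<^sup>2\<close>.\<close>

lemma hamming_le_of_common_estimate:
  assumes k: "1 \<le> k" "k \<le> n" and \<epsilon>: "0 < \<epsilon>" and \<delta>: "\<delta> = 4 * \<epsilon> / sqrt (real (n choose k))"
    and \<Phi>: "superoperator (2 ^ n) \<Phi>"
    and v: "v \<in> nsets {..<n} k \<rightarrow> {- 1, 1}" and w: "w \<in> nsets {..<n} k \<rightarrow> {- 1, 1}"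
    and dv: "diamond_norm (2 ^ n) (\<lambda>X. \<Phi> X - generator n k \<delta> v X) \<le> \<epsilon>"
    and dw: "diamond_norm (2 ^ n) (\<lambda>X. \<Phi> X - generator n k \<delta> w X) \<le> \<epsilon>"
  shows "real (card {S \<in> nsets {..<n} k. v S \<noteq> w S}) \<le> 1 / 16 * real (card (nsets {..<n} k))"
proof -
  let ?I = "nsets {..<n} k"
  have fin: "finite ?I" by (simp add: finite_imp_finite_nsets)
  have cardI: "card ?I = n choose k" by simp
  have D: "0 < real (n choose k)" using k by simp
  define f where "f = energy n k \<delta> (\<lambda>S. v S - w S)"
  have gap: "\<bar>f a - f b\<bar> \<le> 2 * \<epsilon>" if ab: "a < 2 ^ n" "b < 2 ^ n" for a b
  proof -
    let ?U = "matrix_unit (2 ^ n) a b"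
    have "?U $$ (a, b) = 1" using ab by (simp add: matrix_unit_def)
    then have gen: "generator n k \<delta> u ?U $$ (a, b) = - \<i> * of_real (energy n k \<delta> u a - energy n k \<delta> u b)" for u
      using generator_entry[OF matrix_unit_carrier ab, of k \<delta> u] by simp
    have bound: "cmod (\<Phi> ?U $$ (a, b) - generator n k \<delta> u ?U $$ (a, b)) \<le> \<epsilon>"
      if "diamond_norm (2 ^ n) (\<lambda>X. \<Phi> X - generator n k \<delta> u X) \<le> \<epsilon>" for u
    proof -
      have "\<Phi> ?U \<in> carrier_mat (2 ^ n) (2 ^ n)" using \<Phi> unfolding superoperator_def by simp
      moreover have "generator n k \<delta> u ?U \<in> carrier_mat (2 ^ n) (2 ^ n)" by (simp add: generator_carrier)
      ultimately have "(\<Phi> ?U - generator n k \<delta> u ?U) $$ (a, b) = \<Phi> ?U $$ (a, b) - generator n k \<delta> u ?U $$ (a, b)"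
        using ab by simp
      then show ?thesis
        using entry_le_diamond_norm[OF superoperator_diff[OF \<Phi> superoperator_generator] ab, of k \<delta> u] that
        by simp
    qed
    have "cmod (generator n k \<delta> v ?U $$ (a, b) - generator n k \<delta> w ?U $$ (a, b)) \<le> \<epsilon> + \<epsilon>"
      using norm_triangle_ineq4[of "\<Phi> ?U $$ (a, b) - generator n k \<delta> w ?U $$ (a, b)"
          "\<Phi> ?U $$ (a, b) - generator n k \<delta> v ?U $$ (a, b)"] bound[OF dv] bound[OF dw]
      by simp
    also have "generator n k \<delta> v ?U $$ (a, b) - generator n k \<delta> w ?U $$ (a, b) = - \<i> * of_real (f a - f b)"
      unfolding gen f_def energy_diff[symmetric] by (simp add: algebra_simps)
    also have "cmod \<dots> = \<bar>f a - f b\<bar>"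
      by (simp only: norm_mult norm_minus_cancel norm_ii norm_of_real mult_1)
    finally show ?thesis by simp
  qed
  have "\<bar>f a\<bar> \<le> 2 * \<epsilon>" if a: "a < 2 ^ n" for a
  proof -
    \<comment> \<open>As \<open>f\<close> has mean zero, \<open>f a\<close> is the average of the
      gaps \<open>f a - f b\<close>.\<close>
    have "2 ^ n * \<bar>f a\<bar> = \<bar>\<Sum>b<2 ^ n. f a - f b\<bar>"
      using sum_energy[OF k(1), of n \<delta> "\<lambda>S. v S - w S"] by (simp add: sum_subtractf f_def abs_mult)
    also have "\<dots> \<le> (\<Sum>b<(2 :: nat) ^ n. 2 * \<epsilon>)"
      by (rule order_trans[OF sum_abs], rule sum_mono) (use gap[OF a] in simp)
    finally show ?thesis by simp
  qed
  then have "(f a)\<^sup>2 \<le> (2 * \<epsilon>)\<^sup>2" if "a < 2 ^ n" for a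
    using that \<epsilon> by (intro abs_le_square_iff[THEN iffD1]) auto
  then have "(\<Sum>a<2 ^ n. (f a)\<^sup>2) \<le> (\<Sum>a<(2 :: nat) ^ n. (2 * \<epsilon>)\<^sup>2)"
    by (intro sum_mono) auto
  then have "2 ^ n * (\<delta>\<^sup>2 * (\<Sum>S\<in>?I. (v S - w S)\<^sup>2)) \<le> 2 ^ n * (2 * \<epsilon>)\<^sup>2"
    unfolding f_def sum_energy_square by (simp add: mult.assoc)
  then have le: "\<delta>\<^sup>2 * (\<Sum>S\<in>?I. (v S - w S)\<^sup>2) \<le> (2 * \<epsilon>)\<^sup>2" by simp
  have "(\<Sum>S\<in>?I. (v S - w S)\<^sup>2) = (\<Sum>S\<in>?I. if v S \<noteq> w S then 4 else 0)"
  proof (intro sum.cong refl)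
    fix S assume "S \<in> ?I"
    then have "v S = 1 \<or> v S = - 1" "w S = 1 \<or> w S = - 1" using v w by auto
    then show "(v S - w S)\<^sup>2 = (if v S \<noteq> w S then 4 else 0)" by auto
  qed
  also have "\<dots> = 4 * real (card {S \<in> ?I. v S \<noteq> w S})"
    using fin by (simp add: sum.If_cases Int_def)
  \<comment> \<open>Each disagreement contributes 4, so with \<delta>^2 = 16 \<epsilon>^2 / D at
    most D / 16 disagreements fit below 4 \<epsilon>^2.\<close>
  finally have "\<delta>\<^sup>2 * (4 * real (card {S \<in> ?I. v S \<noteq> w S})) \<le> (2 * \<epsilon>)\<^sup>2"
    using le by simp
  moreover have sq: "\<delta>\<^sup>2 = 16 * \<epsilon>\<^sup>2 / real (n choose k)"
    using D unfolding \<delta> by (simp add: power_divide power_mult_distrib)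
  ultimately have "16 * \<epsilon>\<^sup>2 / real (n choose k) * (4 * real (card {S \<in> ?I. v S \<noteq> w S})) \<le> (2 * \<epsilon>)\<^sup>2"
    by (simp only: sq)
  then have "real (card {S \<in> ?I. v S \<noteq> w S}) * 16 * \<epsilon>\<^sup>2 \<le> real (n choose k) * \<epsilon>\<^sup>2"
    using D by (simp add: field_simps power2_eq_square)
  then show ?thesis using \<epsilon> cardI by simp
qed

section \<open>Affinity of transcripts and Assouad's lemma\<close>

lemma sum_transcripts_Suc:
  "(\<Sum>h\<in>transcripts n (Suc N). f h) = (\<Sum>h\<in>transcripts n N. \<Sum>b | length b = n. f (h @ [b]))"
proof -
  have "transcripts n (Suc N) = (\<lambda>(h, b). h @ [b]) ` (transcripts n N \<times> {b. length b = n})"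
  proof (intro equalityI subsetI)
    fix h assume h: "h \<in> transcripts n (Suc N)"
    then have "h \<noteq> []" by (auto simp: transcripts_def)
    then obtain g b where "h = g @ [b]" by (metis append_butlast_last_id)
    then show "h \<in> (\<lambda>(h, b). h @ [b]) ` (transcripts n N \<times> {b. length b = n})"
      using h by (auto simp: transcripts_def)
  qed (auto simp: transcripts_def)
  moreover have "inj_on (\<lambda>(h, b). h @ [b]) (transcripts n N \<times> {b. length b = n})"
    by (auto simp: inj_on_def)
  ultimately show ?thesis
    by (simp add: sum.reindex case_prod_unfold sum.cartesian_product)
qed

lemma transcripts_0 [simp]: "transcripts n 0 = {[]}"
  by (auto simp: transcripts_def)

lemma finite_transcripts [simp]: "finite (transcripts n N)"
proof -
  have "finite {b :: outcome. set b \<subseteq> UNIV \<and> length b = n}"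
    by (rule finite_lists_length_eq) simp
  then have "finite {b :: outcome. length b = n}" by simp
  then have "finite {h. set h \<subseteq> {b :: outcome. length b = n} \<and> length h = N}"
    by (rule finite_lists_length_eq)
  moreover have "transcripts n N = {h. set h \<subseteq> {b. length b = n} \<and> length h = N}"
    unfolding transcripts_def by blast
  ultimately show ?thesis by metis
qed

lemma transcript_prob_snoc:
  "transcript_prob n L P (h @ [b]) = transcript_prob n L P h * shot_prob n L P h b"
proof -
  have "(\<Prod>m<length h. shot_prob n L P (take m (h @ [b])) ((h @ [b]) ! m))
      = (\<Prod>m<length h. shot_prob n L P (take m h) (h ! m))"
    by (intro prod.cong) (auto simp: nth_append)
  then show ?thesis by (simp add: transcript_prob_def)
qed

lemma take_transcripts: "h \<in> transcripts n N \<Longrightarrow> m \<le> N \<Longrightarrow> take m h \<in> transcripts n m"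
  by (auto simp: transcripts_def dest: in_set_takeD)

lemma transcript_prob_nonneg:
  assumes "\<And>m h b. m < N \<Longrightarrow> h \<in> transcripts n m \<Longrightarrow> 0 \<le> shot_prob n L P h b"
    and "h \<in> transcripts n N"
  shows "0 \<le> transcript_prob n L P h"
  unfolding transcript_prob_def
proof (intro prod_nonneg)
  fix m assume "m \<in> {..<length h}"
  then have "m < N" using assms(2) by (simp add: transcripts_def)
  then show "0 \<le> shot_prob n L P (take m h) (h ! m)"
    using assms(1) take_transcripts[OF assms(2)] by simp
qed

lemma sum_transcript_prob:
  assumes "\<And>m h. m < N \<Longrightarrow> h \<in> transcripts n m \<Longrightarrow> (\<Sum>b | length b = n. shot_prob n L P h b) = 1"
  shows "(\<Sum>h\<in>transcripts n N. transcript_prob n L P h) = 1"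
  using assms
proof (induction N)
  case 0
  then show ?case by (simp add: transcript_prob_def)
next
  case (Suc N)
  have "(\<Sum>h\<in>transcripts n (Suc N). transcript_prob n L P h)
      = (\<Sum>h\<in>transcripts n N. transcript_prob n L P h * (\<Sum>b | length b = n. shot_prob n L P h b))"
    by (simp add: sum_transcripts_Suc transcript_prob_snoc sum_distrib_left)
  also have "\<dots> = (\<Sum>h\<in>transcripts n N. transcript_prob n L P h)"
    by (intro sum.cong refl) (simp only: Suc.prems[OF lessI] mult_1_right)
  also have "\<dots> = 1"
    by (intro Suc.IH Suc.prems less_SucI)
  finally show ?case .
qed

text \<open>The choices depend on the earlier outcomes only, so after a fixed \<open>h\<close> both
  generators face the same next shot, with affinity at least \<open>r\<close>. Uniformity in
  \<open>h\<close> lets this factor be pulled out of the sum.\<close>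

lemma transcript_affinity:
  assumes "\<And>m h. m < N \<Longrightarrow> h \<in> transcripts n m \<Longrightarrow>
      r \<le> (\<Sum>b | length b = n. sqrt (shot_prob n L P h b * shot_prob n L' P h b))"
    and "\<And>m h b. m < N \<Longrightarrow> h \<in> transcripts n m \<Longrightarrow> 0 \<le> shot_prob n L P h b"
    and "\<And>m h b. m < N \<Longrightarrow> h \<in> transcripts n m \<Longrightarrow> 0 \<le> shot_prob n L' P h b"
    and "0 \<le> r"
  shows "r ^ N \<le> (\<Sum>h\<in>transcripts n N. sqrt (transcript_prob n L P h * transcript_prob n L' P h))"
  using assms
proof (induction N)
  case 0
  then show ?case by (simp add: transcript_prob_def)
next
  case (Suc N)
  let ?A = "\<lambda>h. sqrt (transcript_prob n L P h * transcript_prob n L' P h)"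
  let ?a = "\<lambda>h b. sqrt (shot_prob n L P h b * shot_prob n L' P h b)"
  have nn: "0 \<le> ?A h" if "h \<in> transcripts n N" for h
    by (intro real_sqrt_ge_zero mult_nonneg_nonneg transcript_prob_nonneg[OF _ that]
        Suc.prems(2,3) less_SucI)
  have "r ^ N \<le> (\<Sum>h\<in>transcripts n N. ?A h)"
    by (intro Suc.IH Suc.prems less_SucI)
  from mult_right_mono[OF this \<open>0 \<le> r\<close>] have "r ^ Suc N \<le> (\<Sum>h\<in>transcripts n N. ?A h) * r"
    by (simp add: mult.commute)
  also have "\<dots> = (\<Sum>h\<in>transcripts n N. ?A h * r)"
    by (rule sum_distrib_right)
  also have "\<dots> \<le> (\<Sum>h\<in>transcripts n N. ?A h * (\<Sum>b | length b = n. ?a h b))"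
    by (intro sum_mono mult_left_mono nn Suc.prems(1)[OF lessI])
  also have "\<dots> = (\<Sum>h\<in>transcripts n (Suc N). ?A h)"
    by (simp add: sum_transcripts_Suc transcript_prob_snoc sum_distrib_left real_sqrt_mult mult_ac)
  finally show ?case .
qed

text \<open>Le Cam's inequality: 1 - (sum of minima) is the total variation distance. Cauchy-Schwarz
  is applied to p q = min * max, and the maxima sum to 2 minus the sum of the minima.\<close>

lemma sum_min_ge_affinity:
  fixes p q :: "'a \<Rightarrow> real"
  assumes nn: "\<And>x. x \<in> X \<Longrightarrow> 0 \<le> p x" "\<And>x. x \<in> X \<Longrightarrow> 0 \<le> q x"
    and one: "(\<Sum>x\<in>X. p x) = 1" "(\<Sum>x\<in>X. q x) = 1"
  shows "(\<Sum>x\<in>X. sqrt (p x * q x))\<^sup>2 \<le> 1 - (1 - (\<Sum>x\<in>X. min (p x) (q x)))\<^sup>2"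
proof -
  let ?m = "\<Sum>x\<in>X. min (p x) (q x)"
  have "(\<Sum>x\<in>X. max (p x) (q x)) + ?m = (\<Sum>x\<in>X. p x + q x)"
    unfolding sum.distrib[symmetric] by (intro sum.cong) auto
  then have M: "(\<Sum>x\<in>X. max (p x) (q x)) = 2 - ?m"
    by (simp add: sum.distrib one)
  have "(\<Sum>x\<in>X. sqrt (p x * q x)) = (\<Sum>x\<in>X. sqrt (min (p x) (q x)) * sqrt (max (p x) (q x)))"
    by (intro sum.cong) (auto simp: min_def max_def real_sqrt_mult)
  also have "\<dots>\<^sup>2 \<le> (\<Sum>x\<in>X. (sqrt (min (p x) (q x)))\<^sup>2) * (\<Sum>x\<in>X. (sqrt (max (p x) (q x)))\<^sup>2)"
    by (rule Cauchy_Schwarz_ineq_sum)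
  also have "\<dots> = ?m * (\<Sum>x\<in>X. max (p x) (q x))"
    using nn by (intro arg_cong2[of _ _ _ _ "(*)"] sum.cong) (auto simp: le_max_iff_disj)
  also have "\<dots> = 1 - (1 - ?m)\<^sup>2"
    unfolding M by (simp add: power2_eq_square algebra_simps)
  finally show ?thesis .
qed

lemma card_eq_sum_if: "finite A \<Longrightarrow> real (card {x \<in> A. Q x}) = (\<Sum>x\<in>A. if Q x then 1 else 0)"
  by (simp add: sum.If_cases Int_def)

text \<open>\<open>G v\<close> is the set of observations accepted as correct under \<open>v\<close>; the proof decodes \<open>h\<close> to any
  \<open>w\<close> with \<open>h \<in> G w\<close> and compares both bounds on the average Hamming error of this decoder.\<close>

lemma assouad:
  fixes p :: "('i \<Rightarrow> real) \<Rightarrow> 'h \<Rightarrow> real" and \<kappa> m :: real and I :: "'i set"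
  defines "V \<equiv> PiE I (\<lambda>_. {- 1, 1 :: real})"
  assumes I: "finite I" "I \<noteq> {}" and T: "finite T"
    and nn: "\<And>v h. v \<in> V \<Longrightarrow> h \<in> T \<Longrightarrow> 0 \<le> p v h"
    and one: "\<And>v. v \<in> V \<Longrightarrow> (\<Sum>h\<in>T. p v h) = 1"
    and close: "\<And>v i. v \<in> V \<Longrightarrow> i \<in> I \<Longrightarrow> m \<le> (\<Sum>h\<in>T. min (p v h) (p (v(i := - v i)) h))"
    and G: "\<And>v. v \<in> V \<Longrightarrow> G v \<subseteq> T"
    and sep: "\<And>v w h. v \<in> V \<Longrightarrow> w \<in> V \<Longrightarrow> h \<in> G v \<Longrightarrow> h \<in> G w \<Longrightarrow>
      real (card {i \<in> I. v i \<noteq> w i}) \<le> \<kappa> * real (card I)"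
  shows "(1 - \<kappa>) * (\<Sum>v\<in>V. \<Sum>h\<in>G v. p v h) \<le> (1 - m / 2) * real (card V)"
proof -
  define w where "w h = (SOME v. v \<in> V \<and> h \<in> G v)" for h
  define e where "e v h = real (card {i \<in> I. v i \<noteq> w h i})" for v :: "'i \<Rightarrow> real" and h
  let ?D = "real (card I)"
  have D: "?D > 0" using I by (simp add: card_gt_0_iff)
  have finV: "finite V" unfolding V_def by (intro finite_PiE I) auto
  \<comment> \<open>If no \<open>v\<close> accepts \<open>h\<close>, then \<open>w h\<close> is
    arbitrary, and this trivial bound still applies.\<close>
  have e1: "e v h \<le> ?D" for v h
    unfolding e_def using I by (intro of_nat_mono card_mono) auto
  have e2: "e v h \<le> \<kappa> * ?D" if "v \<in> V" "h \<in> G v" for v h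
  proof -
    have "w h \<in> V \<and> h \<in> G (w h)" unfolding w_def by (rule someI[of _ v]) (use that in auto)
    then show ?thesis unfolding e_def using sep that by blast
  qed
  have upper: "(\<Sum>h\<in>T. p v h * e v h) \<le> ?D * (1 - (1 - \<kappa>) * (\<Sum>h\<in>G v. p v h))" if v: "v \<in> V" for v
  proof -
    have split: "(\<Sum>h\<in>T. f h) = (\<Sum>h\<in>G v. f h) + (\<Sum>h\<in>T - G v. f h)" for f :: "'h \<Rightarrow> real"
      using sum.subset_diff[OF G[OF v] T, of f] by simp
    have "(\<Sum>h\<in>G v. p v h * e v h) \<le> (\<Sum>h\<in>G v. p v h * (\<kappa> * ?D))"
      using v G nn e2 by (intro sum_mono mult_left_mono) auto
    moreover have "(\<Sum>h\<in>T - G v. p v h * e v h) \<le> (\<Sum>h\<in>T - G v. p v h * ?D)"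
      using v nn e1 by (intro sum_mono mult_left_mono) auto
    ultimately have "(\<Sum>h\<in>T. p v h * e v h)
        \<le> (\<Sum>h\<in>G v. p v h) * (\<kappa> * ?D) + (\<Sum>h\<in>T - G v. p v h) * ?D"
      unfolding split[of "\<lambda>h. p v h * e v h"] by (simp add: sum_distrib_right)
    also have "(\<Sum>h\<in>T - G v. p v h) = 1 - (\<Sum>h\<in>G v. p v h)"
      using split[of "p v"] one[OF v] by simp
    finally show ?thesis by (simp add: algebra_simps)
  qed
  have coord: "m / 2 * real (card V) \<le> (\<Sum>v\<in>V. \<Sum>h\<in>T. p v h * (if v i \<noteq> w h i then 1 else 0))" (is "_ \<le> ?R")
    if i: "i \<in> I" for i
  proof -
    let ?\<phi> = "\<lambda>v. v(i := - v i)"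
    have inV: "?\<phi> v \<in> V" if "v \<in> V" for v
      using that i unfolding V_def by (auto simp: PiE_iff extensional_def)
    have vi: "v i = 1 \<or> v i = - 1" if "v \<in> V" for v
      using that i unfolding V_def by (auto dest: PiE_mem)
    have bij: "bij_betw ?\<phi> V V"
      by (rule bij_betw_byWitness[of _ ?\<phi>]) (use inV in auto)
    \<comment> \<open>Pairing \<open>v\<close> with its flip: whatever \<open>w h i\<close> is, it
      differs from \<open>v i\<close> or from \<open>- v i\<close>, so at least the smaller of the
      two probabilities is counted as error.\<close>
    have "?R = (\<Sum>v\<in>V. \<Sum>h\<in>T. p (?\<phi> v) h * (if ?\<phi> v i \<noteq> w h i then 1 else 0))"
      by (rule sum.reindex_bij_betw[OF bij, symmetric])
    then have "2 * ?R = (\<Sum>v\<in>V. \<Sum>h\<in>T. p v h * (if v i \<noteq> w h i then 1 else 0)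
        + p (?\<phi> v) h * (if ?\<phi> v i \<noteq> w h i then 1 else 0))"
      by (simp add: sum.distrib)
    also have "\<dots> \<ge> (\<Sum>v\<in>V. m)"
    proof (intro sum_mono order_trans[OF close[OF _ i]])
      fix v h assume v: "v \<in> V" and h: "h \<in> T"
      show "min (p v h) (p (?\<phi> v) h) \<le> p v h * (if v i \<noteq> w h i then 1 else 0)
        + p (?\<phi> v) h * (if ?\<phi> v i \<noteq> w h i then 1 else 0)"
        using nn[OF v h] nn[OF inV[OF v] h] vi[OF v] by auto
    qed
    finally show ?thesis by (simp add: mult.commute)
  qed
  have "?D * (m / 2 * real (card V)) \<le> (\<Sum>i\<in>I. \<Sum>v\<in>V. \<Sum>h\<in>T. p v h * (if v i \<noteq> w h i then 1 else 0))"
    using sum_mono[OF coord, of I "\<lambda>i. i"] by simp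
  also have "\<dots> = (\<Sum>v\<in>V. \<Sum>i\<in>I. \<Sum>h\<in>T. p v h * (if v i \<noteq> w h i then 1 else 0))"
    by (rule sum.swap)
  also have "\<dots> = (\<Sum>v\<in>V. \<Sum>h\<in>T. \<Sum>i\<in>I. p v h * (if v i \<noteq> w h i then 1 else 0))"
    by (intro sum.cong refl sum.swap)
  also have "\<dots> = (\<Sum>v\<in>V. \<Sum>h\<in>T. p v h * e v h)"
    unfolding e_def card_eq_sum_if[OF I(1)] sum_distrib_left ..
  also have "\<dots> \<le> (\<Sum>v\<in>V. ?D * (1 - (1 - \<kappa>) * (\<Sum>h\<in>G v. p v h)))"
    by (intro sum_mono upper)
  also have "\<dots> = ?D * (real (card V) - (1 - \<kappa>) * (\<Sum>v\<in>V. \<Sum>h\<in>G v. p v h))"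
    by (simp add: sum_distrib_left sum_subtractf algebra_simps)
  finally have "m / 2 * real (card V) \<le> real (card V) - (1 - \<kappa>) * (\<Sum>v\<in>V. \<Sum>h\<in>G v. p v h)"
    using D by (simp only: mult_le_cancel_left_pos)
  then show ?thesis by (simp add: algebra_simps)
qed

section \<open>The lower bound\<close>

lemma abs_cos_ge: "1 - x\<^sup>2 / 2 \<le> \<bar>cos x\<bar>" for x :: real
proof -
  have "(sin (x / 2))\<^sup>2 \<le> (x / 2)\<^sup>2"
    unfolding abs_le_square_iff[symmetric] by (rule abs_sin_x_le_abs_x)
  moreover have "cos x = 1 - 2 * (sin (x / 2))\<^sup>2"
    using cos_double_sin[of "x / 2"] by simp
  ultimately show ?thesis by (simp add: power_divide)
qed

context
  fixes n k N :: nat and \<delta> t_max :: real and P :: protocol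
  assumes valid: "valid_protocol n N t_max P"
begin

lemma valid_shot:
  assumes "m < N" "h \<in> transcripts n m"
  shows "\<And>j. j < n \<Longrightarrow> density_operator 2 (input P h j)" "0 \<le> duration P h" "duration P h \<le> t_max"
  using valid assms unfolding valid_protocol_def by auto

lemma valid_transcript_prob:
  shows "h \<in> transcripts n N \<Longrightarrow> 0 \<le> transcript_prob n (generator n k \<delta> v) P h"
    and "(\<Sum>h\<in>transcripts n N. transcript_prob n (generator n k \<delta> v) P h) = 1"
  by (rule transcript_prob_nonneg[of N], rule shot_prob_nonneg, rule valid_shot(1), assumption+)
     (rule sum_transcript_prob, rule sum_shot_prob, rule valid_shot(1), assumption+)

lemma sum_min_transcript_prob:
  assumes S: "S \<in> nsets {..<n} k" and v: "v S \<in> {- 1, 1}"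
  shows "1 - sqrt (real N * (2 * \<delta> * t_max)\<^sup>2) \<le> (\<Sum>h\<in>transcripts n N.
    min (transcript_prob n (generator n k \<delta> v) P h) (transcript_prob n (generator n k \<delta> (v(S := - v S))) P h))"
proof -
  define \<theta> where "\<theta> = 2 * \<delta> * t_max"
  \<comment> \<open>Truncation at 0 keeps \<open>r\<close> admissible in
    \<open>transcript_affinity\<close> and in Bernoulli's inequality when \<theta> is large.\<close>
  define r where "r = max 0 (1 - \<theta>\<^sup>2 / 2)"
  let ?p = "transcript_prob n (generator n k \<delta> v) P"
  let ?q = "transcript_prob n (generator n k \<delta> (v(S := - v S))) P"
  let ?A = "\<Sum>h\<in>transcripts n N. sqrt (?p h * ?q h)"
  let ?m = "\<Sum>h\<in>transcripts n N. min (?p h) (?q h)"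
  have "r ^ N \<le> ?A"
  proof (rule transcript_affinity)
    fix m h assume mh: "m < N" "h \<in> transcripts n m"
    note shot = valid_shot[OF mh]
    have "(2 * \<delta> * duration P h)\<^sup>2 \<le> \<theta>\<^sup>2"
      using shot(2,3) unfolding \<theta>_def power_mult_distrib by (intro mult_left_mono power_mono) auto
    then have "r \<le> \<bar>cos (2 * \<delta> * duration P h)\<bar>"
      using abs_cos_ge[of "2 * \<delta> * duration P h"] unfolding r_def by auto
    also have "\<dots> \<le> (\<Sum>b | length b = n. sqrt (shot_prob n (generator n k \<delta> v) P h b
        * shot_prob n (generator n k \<delta> (v(S := - v S))) P h b))"
      using shot_affinity[where v = v and \<delta> = \<delta>, OF _ S v] shot(1) by blast
    finally show "r \<le> \<dots>" .
  next
    fix m h b assume mh: "m < N" "h \<in> transcripts n m"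
    show "0 \<le> shot_prob n (generator n k \<delta> v) P h b"
      by (rule shot_prob_nonneg) (rule valid_shot(1)[OF mh])
    show "0 \<le> shot_prob n (generator n k \<delta> (v(S := - v S))) P h b"
      by (rule shot_prob_nonneg) (rule valid_shot(1)[OF mh])
  qed (simp add: r_def)
  moreover have "1 - real N * \<theta>\<^sup>2 / 2 \<le> r ^ N"
  proof -
    have "1 - real N * \<theta>\<^sup>2 / 2 \<le> 1 + real N * (r - 1)"
      using mult_left_mono[of "- \<theta>\<^sup>2 / 2" "r - 1" "real N"] by (simp add: r_def)
    also have "\<dots> \<le> (1 + (r - 1)) ^ N"
      by (rule Bernoulli_inequality) (simp add: r_def)
    finally show ?thesis by simp
  qed
  ultimately have A: "1 - real N * \<theta>\<^sup>2 / 2 \<le> ?A" by simp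
  have "1 - real N * \<theta>\<^sup>2 \<le> ?A\<^sup>2"
  \<comment> \<open>Squaring the bound \<open>A\<close> is monotone only while its left side is
    nonnegative; otherwise the claim has a negative left side.\<close>
  proof (cases "real N * \<theta>\<^sup>2 / 2 \<le> 1")
    case True
    then have "(1 - real N * \<theta>\<^sup>2 / 2)\<^sup>2 \<le> ?A\<^sup>2" using A by (intro power_mono) auto
    moreover have "(1 - real N * \<theta>\<^sup>2 / 2)\<^sup>2 = 1 - real N * \<theta>\<^sup>2 + (real N * \<theta>\<^sup>2 / 2)\<^sup>2"
      by (simp add: power2_diff)
    ultimately show ?thesis using zero_le_power2[of "real N * \<theta>\<^sup>2 / 2"] by linarith
  next
    case False
    then show ?thesis using zero_le_power2[of ?A] by linarith
  qed
  moreover have "?A\<^sup>2 \<le> 1 - (1 - ?m)\<^sup>2"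
    by (intro sum_min_ge_affinity valid_transcript_prob)
  ultimately have "(1 - ?m)\<^sup>2 \<le> real N * \<theta>\<^sup>2" by linarith
  then have "1 - ?m \<le> sqrt (real N * \<theta>\<^sup>2)" by (rule real_le_rsqrt)
  then show ?thesis unfolding \<theta>_def by linarith
qed

text \<open>Assouad's bound with \<kappa> = 1/16 and overlap 1 - s: dividing (1 + s) / 2 by 15/16
  gives the factor 8/15.\<close>

lemma sum_success_prob_le:
  defines "V \<equiv> PiE (nsets {..<n} k) (\<lambda>_. {- 1, 1 :: real})"
  assumes k: "1 \<le> k" "k \<le> n" and \<epsilon>: "0 < \<epsilon>" and \<delta>: "\<delta> = 4 * \<epsilon> / sqrt (real (n choose k))"
  shows "(\<Sum>v\<in>V. success_prob n N (generator n k \<delta> v) \<epsilon> P)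
    \<le> 8 / 15 * (1 + sqrt (real N * (2 * \<delta> * t_max)\<^sup>2)) * real (card V)"
proof -
  let ?I = "nsets {..<n} k" and ?s = "sqrt (real N * (2 * \<delta> * t_max)\<^sup>2)"
  let ?G = "\<lambda>v. {h \<in> transcripts n N. diamond_norm (2 ^ n) (\<lambda>X. estimate P h X - generator n k \<delta> v X) \<le> \<epsilon>}"
  have fin: "finite ?I" by (simp add: finite_imp_finite_nsets)
  have "card ?I = n choose k" by simp
  then have ne: "?I \<noteq> {}" using k by (metis card.empty binomial_eq_0_iff not_less)
  have "(1 - 1 / 16) * (\<Sum>v\<in>V. \<Sum>h\<in>?G v. transcript_prob n (generator n k \<delta> v) P h)
      \<le> (1 - (1 - ?s) / 2) * real (card V)"
    unfolding V_def
  proof (rule assouad[OF fin ne finite_transcripts[of n N]])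
    fix v i assume "v \<in> PiE ?I (\<lambda>_. {- 1, 1 :: real})" "i \<in> ?I"
    then show "1 - ?s \<le> (\<Sum>h\<in>transcripts n N. min (transcript_prob n (generator n k \<delta> v) P h)
        (transcript_prob n (generator n k \<delta> (v(i := - v i))) P h))"
      by (intro sum_min_transcript_prob) auto
  next
    fix v w h assume "v \<in> PiE ?I (\<lambda>_. {- 1, 1 :: real})" "w \<in> PiE ?I (\<lambda>_. {- 1, 1 :: real})" "h \<in> ?G v" "h \<in> ?G w"
    moreover from this have "superoperator (2 ^ n) (estimate P h)"
      using valid unfolding valid_protocol_def by auto
    ultimately show "real (card {i \<in> ?I. v i \<noteq> w i}) \<le> 1 / 16 * real (card ?I)"
      by (intro hamming_le_of_common_estimate[OF k \<epsilon> \<delta>]) (auto simp: PiE_iff)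
  qed (auto intro: valid_transcript_prob)
  then show ?thesis
    unfolding success_prob_def by (simp add: field_simps)
qed

end

theorem theorem7p2:
  fixes k :: nat
  assumes "1 \<le> k"
  shows "\<exists>c>0. \<forall>(n :: nat) (N :: nat) (\<epsilon> :: real) (t_max :: real) (\<delta> :: real) (M :: protocol measure).
    k \<le> n \<longrightarrow> 0 < \<epsilon> \<longrightarrow> 0 < t_max \<longrightarrow> \<delta> = 4 * \<epsilon> / sqrt (real (n choose k)) \<longrightarrow>
    randomized_protocol n N t_max M \<longrightarrow>
    (\<forall>v \<in> nsets {..<n} k \<rightarrow> {- 1, 1}. 2 / 3 \<le> random_success_prob n N (generator n k \<delta> v) \<epsilon> M) \<longrightarrow>
    real N \<ge> c * (real n ^ k / (t_max\<^sup>2 * \<epsilon>\<^sup>2))"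
proof (intro exI[of _ "1 / (1024 * real k ^ k)"] conjI allI impI)
  \<comment> \<open>The factor 1024 = 16 * 64 combines s^2 \<ge> 1/16 with s^2 = 64 N \<epsilon>^2
    t_max^2 / D; \<open>k ^ k\<close> comes from D \<ge> (n/k)^k.\<close>
  show "0 < 1 / (1024 * real k ^ k)" using assms by simp
  fix n N :: nat and \<epsilon> t_max \<delta> :: real and M :: "protocol measure"
  assume kn: "k \<le> n" and \<epsilon>: "0 < \<epsilon>" and t: "0 < t_max" and \<delta>: "\<delta> = 4 * \<epsilon> / sqrt (real (n choose k))"
    and M: "randomized_protocol n N t_max M"
    and success: "\<forall>v \<in> nsets {..<n} k \<rightarrow> {- 1, 1}. 2 / 3 \<le> random_success_prob n N (generator n k \<delta> v) \<epsilon> M"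
  interpret prob_space M using M unfolding randomized_protocol_def by blast
  define V where "V = PiE (nsets {..<n} k) (\<lambda>_. {- 1, 1 :: real})"
  define s where "s = sqrt (real N * (2 * \<delta> * t_max)\<^sup>2)"
  let ?f = "\<lambda>v P. success_prob n N (generator n k \<delta> v) \<epsilon> P"
  have finV: "finite V" unfolding V_def by (intro finite_PiE finite_imp_finite_nsets) auto
  have "V \<noteq> {}" unfolding V_def by (simp add: PiE_eq_empty_iff)
  then have V: "0 < real (card V)" using finV by (simp add: card_gt_0_iff)
  have ge: "2 / 3 \<le> (\<integral>P. ?f v P \<partial>M)" if "v \<in> V" for v
    using success that unfolding V_def random_success_prob_def by (auto simp: PiE_iff)
  \<comment> \<open>A non-integrable function would have integral 0, contradicting the lower bound
    2/3.\<close>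
  have int: "integrable M (?f v)" if "v \<in> V" for v
    using ge[OF that] not_integrable_integral_eq[of M "?f v"] by fastforce
  have "2 / 3 * real (card V) \<le> (\<Sum>v\<in>V. \<integral>P. ?f v P \<partial>M)"
    using sum_mono[of V "\<lambda>_. 2 / 3" "\<lambda>v. \<integral>P. ?f v P \<partial>M"] ge by simp
  also have "\<dots> = (\<integral>P. (\<Sum>v\<in>V. ?f v P) \<partial>M)"
    using int by (simp add: Bochner_Integration.integral_sum)
  also have "\<dots> \<le> 8 / 15 * (1 + s) * real (card V)"
  proof (rule integral_le_const)
    show "AE P in M. (\<Sum>v\<in>V. ?f v P) \<le> 8 / 15 * (1 + s) * real (card V)"
      using M unfolding randomized_protocol_def V_def s_def
      by (intro AE_I2 sum_success_prob_le assms kn \<epsilon> \<delta>) auto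
  qed (use int in auto)
  finally have "1 / 4 \<le> s" using V by simp
  then have "(1 / 4)\<^sup>2 \<le> s\<^sup>2" by (intro power_mono) auto
  also have "s\<^sup>2 = real N * (4 * \<delta>\<^sup>2 * t_max\<^sup>2)"
    by (simp add: s_def power_mult_distrib)
  also have "\<delta>\<^sup>2 = 16 * \<epsilon>\<^sup>2 / real (n choose k)"
    unfolding \<delta> by (simp add: power_divide power_mult_distrib)
  finally have N: "real (n choose k) / (1024 * (t_max\<^sup>2 * \<epsilon>\<^sup>2)) \<le> real N"
    using kn \<epsilon> t by (simp add: field_simps)
  have "(real n / real k) ^ k \<le> real (n choose k)"
    by (rule binomial_ge_n_over_k_pow_k[OF kn])
  then have "(real n / real k) ^ k / (1024 * (t_max\<^sup>2 * \<epsilon>\<^sup>2)) \<le> real (n choose k) / (1024 * (t_max\<^sup>2 * \<epsilon>\<^sup>2))"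
    by (intro divide_right_mono) auto
  then show "1 / (1024 * real k ^ k) * (real n ^ k / (t_max\<^sup>2 * \<epsilon>\<^sup>2)) \<le> real N"
    using N by (simp add: power_divide mult_ac)
qed

end
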